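(* Let $K$ be a field of characteristic zero, let $n\ge 1$, and let $R=K[x_1,\ldots,x_n]$. Let $F\in R$ be a homogeneous polynomial of degree $n$ such that the partial derivatives $\frac{\partial F}{\partial x_1},\ldots,\frac{\partial F}{\partial x_n}$ are linearly independent over $K$. Then the Artinian Gorenstein algebra $A(F)=R/\mathrm{Ann}_R(F)$ is a quadratic complete intersection if and only if one of the following conditions is satisfied: (1) the quadratic space $Q(F)$ has dimension $n$ over $K$ and generates $\mathrm{Ann}_R(F)$ as an ideal of $R$; (2) the quadratic space $Q(F)$ contains a regular sequence of length $n$ in $R$.
   Context: Each variable of $R=K[x_1,\ldots,x_n]$ has degree $1$, and $R_d$ denotes the homogeneous component of degree $d$. The ring $R$ is regarded as a module over itself via $f\circ F=f\left(\frac{\partial}{\partial x_1},\ldots,\frac{\partial}{\partial x_n}\right)F$ for $(f,F)\in R\times R$. For $F\in R$, $\mathrm{Ann}_R(F)=\{f\in R\mid f\circ F=0\}$, and $A(F)=R/\mathrm{Ann}_R(F)$. The quadratic space defined by a homogeneous $F$ is $Q(F)=\mathrm{Ann}_R(F)\cap R_2=\{f\in R_2\mid f\circ F=0\}$. For a graded vector space $V=\bigoplus_{i\ge 0}V_i$, the Hilbert series is $H_V(T)=\sum_{i\ge 0}(\dim_K V_i)T^i$. A graded Artinian algebra $A=R/I$ ($I$ a homogeneous ideal) is called a quadratic complete intersection if it is a complete intersection (that is, $I$ is generated by a regular sequence of homogeneous elements of $R$) and its Hilbert series is $(1+T)^d$ for some $d$ (the ideal $I$ is allowed to contain linear forms).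 *)

theory Defs
  imports
    "HOL-Library.Cardinality"
    "HOL-Library.Poly_Mapping"
    "HOL-Computational_Algebra.Formal_Power_Series"
    "HOL-Algebra.Embedded_Algebras"
    "HOL-Algebra.QuotRing"
    "HOL-Decision_Procs.Algebra_Aux"
begin

text \<open>Polynomials over \<open>'k\<close> in the variables \<open>x\<^sub>i\<close> for \<open>i :: 'n\<close>: an exponent vector \<open>'n \<Rightarrow>\<^sub>0 nat\<close>
  is mapped to its coefficient. For \<open>'n :: finite\<close> the number of variables is \<open>CARD('n)\<close>.\<close>

type_synonym ('n, 'k) mpoly = "('n \<Rightarrow>\<^sub>0 nat) \<Rightarrow>\<^sub>0 'k"

abbreviation mpoly_ring :: "('n, 'k::field_char_0) mpoly ring" where
  "mpoly_ring \<equiv> cring_class_ops"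

definition const :: "'k \<Rightarrow> ('n, 'k::field_char_0) mpoly" where
  "const c = Poly_Mapping.single 0 c"

text \<open>The copy of the field \<open>'k\<close> inside the polynomial ring.\<close>

definition const_field :: "('n, 'k::field_char_0) mpoly set" where
  "const_field = range const"

definition homogeneous_component :: "nat \<Rightarrow> ('n::finite, 'k::field_char_0) mpoly set" where
  "homogeneous_component d = {f. \<forall>m\<in>Poly_Mapping.keys f. (\<Sum>i\<in>UNIV. Poly_Mapping.lookup m i) = d}"

text \<open>If \<open>x\<^sub>i\<close> does not occur in the monomial \<open>m\<close>, the truncated exponent in the summand for
  \<open>m\<close> is harmless because its coefficient vanishes.\<close>

definition partial_deriv :: "'n \<Rightarrow> ('n, 'k::field_char_0) mpoly \<Rightarrow> ('n, 'k) mpoly" where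
  "partial_deriv i F =
     (\<Sum>m\<in>Poly_Mapping.keys F. Poly_Mapping.single (m - Poly_Mapping.single i 1) (of_nat (Poly_Mapping.lookup m i) * Poly_Mapping.lookup F m))"

text \<open>The operator obtained from the monomial \<open>m\<close> by substituting \<open>\<partial>/\<partial>x\<^sub>i\<close> for \<open>x\<^sub>i\<close>, for all \<open>i\<close>.
  The partial derivatives commute, so the composition over all variables is independent of their order.\<close>

definition monomial_deriv ::
    "('n::finite \<Rightarrow>\<^sub>0 nat) \<Rightarrow> ('n, 'k::field_char_0) mpoly \<Rightarrow> ('n, 'k) mpoly" where
  "monomial_deriv m F = Finite_Set.fold (\<lambda>i. partial_deriv i ^^ Poly_Mapping.lookup m i) F UNIV"

definition diff_action ::
    "('n::finite, 'k::field_char_0) mpoly \<Rightarrow> ('n, 'k) mpoly \<Rightarrow> ('n, 'k) mpoly" where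
  "diff_action f F = (\<Sum>m\<in>Poly_Mapping.keys f. const (Poly_Mapping.lookup f m) * monomial_deriv m F)"

definition Ann :: "('n::finite, 'k::field_char_0) mpoly \<Rightarrow> ('n, 'k) mpoly set" where
  "Ann F = {f. diff_action f F = 0}"

definition quadratic_space :: "('n::finite, 'k::field_char_0) mpoly \<Rightarrow> ('n, 'k) mpoly set" where
  "quadratic_space F = Ann F \<inter> homogeneous_component 2"

definition regular_sequence :: "('a, 'b) ring_scheme \<Rightarrow> 'a list \<Rightarrow> bool" where
  "regular_sequence R fs \<longleftrightarrow>
     set fs \<subseteq> carrier R \<and>
     (\<forall>i<length fs. \<forall>g\<in>carrier R.
        fs ! i \<otimes>\<^bsub>R\<^esub> g \<in> genideal R (set (take i fs)) \<longrightarrow> g \<in> genideal R (set (take i fs))) \<and>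
     genideal R (set fs) \<noteq> carrier R"

definition artinian :: "('a, 'b) ring_scheme \<Rightarrow> bool" where
  "artinian R \<longleftrightarrow>
     (\<forall>J :: nat \<Rightarrow> 'a set.
        (\<forall>k. ideal (J k) R \<and> J (Suc k) \<subseteq> J k) \<longrightarrow> (\<exists>m. \<forall>k\<ge>m. J k = J m))"

definition quotient_map ::
    "('n, 'k::field_char_0) mpoly set \<Rightarrow> ('n, 'k) mpoly \<Rightarrow> ('n, 'k) mpoly set" where
  "quotient_map I f = I +>\<^bsub>mpoly_ring\<^esub> f"

text \<open>For a homogeneous ideal \<open>I\<close> the graded components of \<open>R/I\<close> are the images of those of \<open>R\<close>;
  their dimension is taken over the image of \<open>'k\<close> in \<open>R/I\<close>.\<close>

definition hilbert_series :: "('n::finite, 'k::field_char_0) mpoly set \<Rightarrow> int fps" where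
  "hilbert_series I = Abs_fps (\<lambda>i.
     int ((ring.dim (mpoly_ring Quot I) over (quotient_map I ` const_field))
            (quotient_map I ` homogeneous_component i)))"

text \<open>The property of the graded algebra \<open>R/I\<close>. Homogeneity of \<open>I\<close> is part of being generated by
  homogeneous elements.\<close>

definition quadratic_complete_intersection :: "('n::finite, 'k::field_char_0) mpoly set \<Rightarrow> bool" where
  "quadratic_complete_intersection I \<longleftrightarrow>
     artinian (mpoly_ring Quot I) \<and>
     (\<exists>fs. regular_sequence mpoly_ring fs \<and>
           (\<forall>f\<in>set fs. \<exists>d. f \<in> homogeneous_component d) \<and>
           I = genideal mpoly_ring (set fs)) \<and>
     (\<exists>d. hilbert_series I = (1 + fps_X) ^ d)"

end

theory Submission
  imports Defs
begin

text \<open>After rescaling coefficients by factorials, \<open>Ann F\<close> consists of all \<open>f\<close> with \<open>L (g * f) = 0\<close> for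
  every \<open>g\<close>, where \<open>L\<close> is a linear functional supported in degree \<open>n\<close>.

  If \<open>n\<close> quadrics generate \<open>Ann F\<close>, then the ideal contains high powers of all variables, which form
  a regular sequence of length \<open>n\<close>. By depth sensitivity the Koszul complex of the quadrics is
  exact, so the quadrics form a regular sequence. Hence (1) implies (2).

  If \<open>Q(F)\<close> contains a regular sequence of length \<open>n\<close>, generating an ideal \<open>J\<close>, then \<open>R/J\<close> has Hilbert
  series \<open>(1 + T)^n\<close>, and its socle, being the top homology of the Koszul complex of the
  variables, is one-dimensional. An element of \<open>Ann F\<close> outside \<open>J\<close> has a multiple spanning the
  socle, which would put all forms of degree \<open>n\<close> into \<open>Ann F\<close>. Hence \<open>J = Ann F\<close>.

  Conversely, if homogeneous generators of degrees \<open>d\<^sub>i\<close> form a regular sequence, then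
  \<open>\<Prod>(1 - T^d\<^sub>i) = (1 + T)^d (1 - T)^n\<close>. Since \<open>Ann F\<close> contains no linear forms, comparing coefficients
  shows that there are \<open>n\<close> generators, all of degree two.\<close>

text \<open>The two uses of the Koszul complex sit at its opposite ends: regularity is read off in
  degree one, the socle in degree \<open>n\<close>. Both rest on one mechanism. An element of the
  ideal generated by \<open>f\<close> acts null-homotopically on the Koszul complex of
  \<open>f\<close>. If such an element \<open>a\<close> is a nonzerodivisor modulo \<open>I\<close>,
  the long exact sequence therefore breaks into short pieces linking degree \<open>p + 1\<close>
  over \<open>R/(I, a)\<close> with degree \<open>p\<close> over \<open>R/I\<close>, and a regular
  sequence of length \<open>n\<close> carries information from one end to the other. Chains stay
  over \<open>R\<close> and are compared modulo ideals, which are the submodules of \<open>R\<close>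
  over itself. Vanishing of the first homology alone does not make a sequence regular in its given
  order: \<open>y(1 - x), z(1 - x), x\<close> is a permutation of a regular sequence but is not
  regular. The grading excludes this, through an induction on degree. Characteristic zero keeps the
  factorials invertible, and independence of the partial derivatives says that no nonzero linear
  form annihilates \<open>F\<close>.\<close>

interpretation idl: Modules.module "(*) :: 'a::comm_ring_1 \<Rightarrow> 'a \<Rightarrow> 'a"
  by unfold_locales (auto simp: algebra_simps)

declare idl.scale_scale [simp del] \<comment> \<open>it loops with \<open>mult.assoc\<close>\<close>

section \<open>Koszul complexes\<close>

text \<open>A Koszul chain of degree \<open>p\<close> on \<open>n\<close> ring elements assigns to every \<open>p\<close>-element subset of
  \<open>{..<n}\<close> the coefficient of the corresponding wedge product. The differential and the contracting
  homotopies are combinations of contractions and wedges, which satisfy the canonical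
  anticommutation relations.\<close>

definition koszul_sign :: "nat \<Rightarrow> nat set \<Rightarrow> 'a::comm_ring_1" where
  "koszul_sign i S = (-1) ^ card {j\<in>S. j < i}"

definition contract :: "nat \<Rightarrow> (nat set \<Rightarrow> 'a::comm_ring_1) \<Rightarrow> nat set \<Rightarrow> 'a" where
  "contract i c S = (if i \<in> S then 0 else koszul_sign i S * c (insert i S))"

definition wedge :: "nat \<Rightarrow> (nat set \<Rightarrow> 'a::comm_ring_1) \<Rightarrow> nat set \<Rightarrow> 'a" where
  "wedge i c S = (if i \<in> S then koszul_sign i S * c (S - {i}) else 0)"

definition koszul_d :: "(nat \<Rightarrow> 'a::comm_ring_1) \<Rightarrow> nat \<Rightarrow> (nat set \<Rightarrow> 'a) \<Rightarrow> nat set \<Rightarrow> 'a" where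
  "koszul_d f n c S = (\<Sum>i<n. f i * contract i c S)"

definition koszul_h :: "(nat \<Rightarrow> 'a::comm_ring_1) \<Rightarrow> nat \<Rightarrow> (nat set \<Rightarrow> 'a) \<Rightarrow> nat set \<Rightarrow> 'a" where
  "koszul_h b n c S = (\<Sum>i<n. b i * wedge i c S)"

definition koszul_chain :: "nat \<Rightarrow> nat \<Rightarrow> (nat set \<Rightarrow> 'a::comm_ring_1) \<Rightarrow> bool" where
  "koszul_chain n p c \<longleftrightarrow> (\<forall>S. c S \<noteq> 0 \<longrightarrow> S \<subseteq> {..<n} \<and> card S = p)"

lemma koszul_sign_insert:
  assumes "j \<notin> S"
  shows "koszul_sign i (insert j S) = (if j < i then - koszul_sign i S else koszul_sign i S)"
proof -
  have eq: "{k\<in>insert j S. k < i} = (if j < i then insert j {k\<in>S. k < i} else {k\<in>S. k < i})"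
    by auto
  show ?thesis using assms by (simp only: koszul_sign_def eq) simp
qed

lemma koszul_sign_remove:
  assumes "j \<in> S"
  shows "(koszul_sign i (S - {j}) :: 'a::comm_ring_1) = (if j < i then - koszul_sign i S else koszul_sign i S)"
  using koszul_sign_insert[of j "S - {j}" i, where ?'a = 'a] assms
  by (auto simp: insert_absorb split: if_splits)

lemma koszul_sign_square: "koszul_sign i S * koszul_sign i S = 1"
  by (simp add: koszul_sign_def flip: power_add mult_2)

lemma koszul_sign_square_left: "koszul_sign i S * (koszul_sign i S * x) = x"
  by (simp add: koszul_sign_square flip: mult.assoc)

lemma contract_anticommute: "contract i (contract j c) S + contract j (contract i c) S = 0"
  by (cases "i = j")
    (auto simp: contract_def koszul_sign_insert insert_commute algebra_simps)

text \<open>For \<open>i = j\<close> exactly one of the two terms survives, depending on whether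
  \<open>i\<close> lies in \<open>S\<close>. For \<open>i \<noteq> j\<close> both terms need
  \<open>j\<close> in \<open>S\<close> and \<open>i\<close> outside; inserting \<open>i\<close> or
  removing \<open>j\<close> then flips exactly one of the two signs, the one belonging to the larger
  index, so the terms cancel.\<close>

lemma contract_wedge:
  "contract i (wedge j c) S + wedge j (contract i c) S = (if i = j then c S else 0)"
proof (cases "i = j")
  case True
  then show ?thesis
    by (cases "j \<in> S")
      (simp_all add: contract_def wedge_def koszul_sign_insert koszul_sign_remove
        koszul_sign_square koszul_sign_square_left insert_absorb)
next
  case False
  then have ins: "insert i S - {j} = insert i (S - {j})" by auto
  show ?thesis
  proof (cases "i \<notin> S \<and> j \<in> S")
    case True
    then have "contract i (wedge j c) S
        = koszul_sign i S * (koszul_sign j (insert i S) * c (insert i (S - {j})))"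
      by (simp add: contract_def wedge_def ins)
    moreover have "wedge j (contract i c) S
        = koszul_sign j S * (koszul_sign i (S - {j}) * c (insert i (S - {j})))"
      using True by (simp add: contract_def wedge_def)
    ultimately show ?thesis
      using True False by (cases "i < j") (simp_all add: koszul_sign_insert koszul_sign_remove)
  next
    case outside: False
    with False show ?thesis by (auto simp: contract_def wedge_def)
  qed
qed

lemma contract_sum: "contract i (\<lambda>S. \<Sum>j\<in>A. b j * g j S) S = (\<Sum>j\<in>A. b j * contract i (g j) S)"
  by (auto simp: contract_def sum_distrib_left algebra_simps)

lemma wedge_sum: "wedge i (\<lambda>S. \<Sum>j\<in>A. b j * g j S) S = (\<Sum>j\<in>A. b j * wedge i (g j) S)"
  by (auto simp: wedge_def sum_distrib_left algebra_simps)

text \<open>The diagonal is a separate assumption because antisymmetry only gives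
  \<open>2 * g i i = 0\<close>, and there may be 2-torsion.\<close>

lemma sum_antisymmetric:
  fixes g :: "nat \<Rightarrow> nat \<Rightarrow> 'a::ab_group_add"
  assumes "\<And>i j. g i j + g j i = 0" "\<And>i. g i i = 0"
  shows "(\<Sum>i<n. \<Sum>j<n. g i j) = 0"
proof (induction n)
  case (Suc n)
  have "(\<Sum>i<n. g i n) + (\<Sum>j<n. g n j) = 0"
    using assms(1) by (simp flip: sum.distrib)
  with Suc assms(2) show ?case by (simp add: sum.distrib algebra_simps)
qed simp

lemma koszul_d_d: "koszul_d f n (koszul_d f n c) S = 0"
proof -
  have "koszul_d f n (koszul_d f n c) S = (\<Sum>i<n. \<Sum>j<n. f i * f j * contract i (contract j c) S)"
    by (simp add: koszul_d_def[abs_def] contract_sum sum_distrib_left algebra_simps)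
  also have "\<dots> = 0"
  proof (rule sum_antisymmetric)
    fix i j
    show "f i * f j * contract i (contract j c) S + f j * f i * contract j (contract i c) S = 0"
      by (metis contract_anticommute distrib_left mult.commute mult_zero_right)
    show "f i * f i * contract i (contract i c) S = 0" by (simp add: contract_def)
  qed
  finally show ?thesis .
qed

text \<open>Coefficients are indexed by positions, so repeated values of \<open>f\<close> do no
  harm. They become the weights of the contracting homotopy.\<close>

lemma span_image_lessThan:
  assumes "a \<in> idl.span (f ` {..<n::nat})"
  obtains b where "a = (\<Sum>i<n. b i * f i)"
proof -
  let ?T = "range (\<lambda>b. \<Sum>i<n. b i * f i)"
  have "idl.subspace ?T"
  proof (rule idl.subspaceI)
    show "0 \<in> ?T" by (rule image_eqI[of _ _ "\<lambda>_. 0"]) auto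
    show "x + y \<in> ?T" if xy: "x \<in> ?T" "y \<in> ?T" for x y
    proof -
      obtain b c where "x = (\<Sum>i<n. b i * f i)" "y = (\<Sum>i<n. c i * f i)" using xy by auto
      then show ?thesis
        by (intro image_eqI[of _ _ "\<lambda>i. b i + c i"]) (auto simp: distrib_right sum.distrib)
    qed
    show "r * x \<in> ?T" if x: "x \<in> ?T" for r x
    proof -
      obtain b where "x = (\<Sum>i<n. b i * f i)" using x by auto
      then show ?thesis
        by (intro image_eqI[of _ _ "\<lambda>i. r * b i"]) (auto simp: sum_distrib_left mult.assoc)
    qed
  qed
  moreover have "f j \<in> ?T" if "j < n" for j
    using that by (intro image_eqI[of _ _ "\<lambda>i. if i = j then 1 else 0"])
      (auto simp: if_distrib[of "\<lambda>x. x * _"] cong: if_cong)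
  ultimately have "idl.span (f ` {..<n}) \<subseteq> ?T" by (intro idl.span_minimal) auto
  with assms that show thesis by auto
qed

text \<open>The anticommutation relations summed with weights \<open>f i * b j\<close>: only the
  diagonal survives. Consequently every element of the ideal generated by \<open>f\<close> acts as
  zero on Koszul homology with any coefficients.\<close>

lemma koszul_homotopy:
  "koszul_d f n (koszul_h b n c) S + koszul_h b n (koszul_d f n c) S = (\<Sum>i<n. b i * f i) * c S"
proof -
  have "koszul_d f n (koszul_h b n c) S = (\<Sum>i<n. \<Sum>j<n. f i * b j * contract i (wedge j c) S)"
    by (simp add: koszul_d_def koszul_h_def[abs_def] contract_sum sum_distrib_left algebra_simps)
  moreover have "koszul_h b n (koszul_d f n c) S = (\<Sum>i<n. \<Sum>j<n. f i * b j * wedge j (contract i c) S)"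
    by (subst sum.swap)
      (simp add: koszul_h_def koszul_d_def[abs_def] wedge_sum sum_distrib_left algebra_simps)
  ultimately have "koszul_d f n (koszul_h b n c) S + koszul_h b n (koszul_d f n c) S
      = (\<Sum>i<n. \<Sum>j<n. f i * b j * (contract i (wedge j c) S + wedge j (contract i c) S))"
    by (simp add: distrib_left sum.distrib)
  also have "\<dots> = (\<Sum>i<n. \<Sum>j<n. if i = j then f i * b j * c S else 0)"
    by (intro sum.cong refl) (simp add: contract_wedge)
  also have "\<dots> = (\<Sum>i<n. f i * b i * c S)" by simp
  finally show ?thesis by (simp add: sum_distrib_left mult.commute)
qed

lemma koszul_d_combine:
  "koszul_d f n (\<lambda>S. a * c S + b * e S) S = a * koszul_d f n c S + b * koszul_d f n e S"
  unfolding koszul_d_def sum_distrib_left sum.distrib[symmetric]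
  by (intro sum.cong refl) (simp add: contract_def algebra_simps)

lemma koszul_d_diff:
  "koszul_d f n (\<lambda>S. c S - e S) S = koszul_d f n c S - koszul_d f n e S"
  using koszul_d_combine[of f n 1 c "-1" e S] by simp

lemma koszul_d_scale: "koszul_d f n (\<lambda>S. a * c S) S = a * koszul_d f n c S"
  using koszul_d_combine[of f n a c 0 c S] by simp

lemma koszul_d_in_ideal:
  assumes "idl.subspace I" "\<And>S. c S \<in> I"
  shows "koszul_d f n c S \<in> I"
  unfolding koszul_d_def contract_def using assms
  by (auto intro!: idl.subspace_sum idl.subspace_scale simp: idl.subspace_0 simp del: mult_zero_right)

lemma koszul_h_in_ideal:
  assumes "idl.subspace I" "\<And>S. c S \<in> I"
  shows "koszul_h f n c S \<in> I"
  unfolding koszul_h_def wedge_def using assms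
  by (auto intro!: idl.subspace_sum idl.subspace_scale simp: idl.subspace_0 simp del: mult_zero_right)

lemma koszul_chain_d:
  assumes "koszul_chain n (Suc p) c" shows "koszul_chain n p (koszul_d f n c)"
  unfolding koszul_chain_def
proof (intro allI impI)
  fix S assume "koszul_d f n c S \<noteq> 0"
  then obtain i where "i < n" "contract i c S \<noteq> 0"
    unfolding koszul_d_def by (force elim: sum.not_neutral_contains_not_neutral)
  then have i: "i \<notin> S" "c (insert i S) \<noteq> 0" by (auto simp: contract_def split: if_splits)
  with assms have *: "insert i S \<subseteq> {..<n}" "card (insert i S) = Suc p"
    by (auto simp: koszul_chain_def)
  then have "finite S" using finite_subset[of "insert i S" "{..<n}"] by simp
  with * i show "S \<subseteq> {..<n} \<and> card S = p" by auto
qed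

lemma koszul_chain_h:
  assumes "koszul_chain n p c" shows "koszul_chain n (Suc p) (koszul_h f n c)"
  unfolding koszul_chain_def
proof (intro allI impI)
  fix S assume "koszul_h f n c S \<noteq> 0"
  then obtain i where n: "i < n" "wedge i c S \<noteq> 0"
    unfolding koszul_h_def by (force elim: sum.not_neutral_contains_not_neutral)
  then have i: "i \<in> S" "c (S - {i}) \<noteq> 0" by (auto simp: wedge_def split: if_splits)
  with assms have *: "S - {i} \<subseteq> {..<n}" "card (S - {i}) = p"
    by (auto simp: koszul_chain_def)
  then have "finite S" using finite_subset[of "S - {i}" "{..<n}"] by simp
  with * i n show "S \<subseteq> {..<n} \<and> card S = Suc p" using card_Suc_Diff1[of S i] by auto
qed

lemma koszul_chain_combine:
  assumes "koszul_chain n p c" "koszul_chain n p e"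
  shows "koszul_chain n p (\<lambda>S. a * c S + b * e S)"
  using assms unfolding koszul_chain_def
  by (metis add.right_neutral mult_zero_right)

lemma koszul_chain_diff:
  assumes "koszul_chain n p c" "koszul_chain n p e"
  shows "koszul_chain n p (\<lambda>S. c S - a * e S)"
  using koszul_chain_combine[OF assms, of 1 "- a"] by simp

text \<open>Vanishing of the Koszul homology of degree \<open>p\<close> with coefficients in
  \<open>R/I\<close>, phrased by lifts to \<open>R\<close> and congruences modulo
  \<open>I\<close>.\<close>

definition koszul_exact :: "(nat \<Rightarrow> 'a::comm_ring_1) \<Rightarrow> nat \<Rightarrow> 'a set \<Rightarrow> nat \<Rightarrow> bool" where
  "koszul_exact f n I p \<longleftrightarrow>
     (\<forall>c. koszul_chain n p c \<and> (\<forall>S. koszul_d f n c S \<in> I) \<longrightarrow>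
       (\<exists>e. koszul_chain n (Suc p) e \<and> (\<forall>S. c S - koszul_d f n e S \<in> I)))"

lemma koszul_exactE:
  assumes "koszul_exact f n I p" "koszul_chain n p c" "\<And>S. koszul_d f n c S \<in> I"
  obtains e where "koszul_chain n (Suc p) e" "\<And>S. c S - koszul_d f n e S \<in> I"
  using assms unfolding koszul_exact_def by blast

lemma koszul_chain_above:
  assumes "koszul_chain n p c" "n < p" shows "c S = 0"
proof (rule ccontr)
  assume "c S \<noteq> 0"
  then have "S \<subseteq> {..<n}" "card S = p" using assms by (auto simp: koszul_chain_def)
  with \<open>n < p\<close> card_mono[of "{..<n}" S] show False by simp
qed

lemma koszul_exact_above:
  assumes "n < p" "idl.subspace I"
  shows "koszul_exact f n I p"
  unfolding koszul_exact_def
proof (intro allI impI, elim conjE)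
  fix c :: "nat set \<Rightarrow> 'a" assume "koszul_chain n p c"
  then have "c = (\<lambda>_. 0)" using koszul_chain_above assms(1) by blast
  then have "koszul_chain n (Suc p) c \<and> (\<forall>S. c S - koszul_d f n c S \<in> I)"
    using assms(2) by (simp add: koszul_chain_def koszul_d_def contract_def idl.subspace_0 cong: if_cong)
  then show "\<exists>e. koszul_chain n (Suc p) e \<and> (\<forall>S. c S - koszul_d f n e S \<in> I)" by blast
qed

definition nonzerodivisor_mod :: "'a::comm_ring_1 set \<Rightarrow> 'a \<Rightarrow> bool" where
  "nonzerodivisor_mod I a \<longleftrightarrow> (\<forall>g. a * g \<in> I \<longrightarrow> g \<in> I)"

text \<open>The multipliers of \<open>a\<close> are chosen one index set at a time, so they are cut
  off outside the \<open>p\<close>-element subsets to obtain a chain again.\<close>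

lemma ideal_insert_chain:
  assumes "koszul_chain n p c" "\<And>S. c S \<in> idl.span (insert a A)"
  obtains w where "koszul_chain n p w" "\<And>S. c S - a * w S \<in> idl.span A"
proof -
  have "\<forall>S. \<exists>k. c S - k * a \<in> idl.span A" using assms(2) by (simp add: idl.span_breakdown_eq)
  then obtain w where w: "\<And>S. c S - w S * a \<in> idl.span A" by metis
  show ?thesis
  proof (rule that[of "\<lambda>S. if S \<subseteq> {..<n} \<and> card S = p then w S else 0"])
    show "koszul_chain n p (\<lambda>S. if S \<subseteq> {..<n} \<and> card S = p then w S else 0)"
      by (auto simp: koszul_chain_def)
    fix S
    have "c S = 0" if "\<not> (S \<subseteq> {..<n} \<and> card S = p)"
      using assms(1) that unfolding koszul_chain_def by blast
    then show "c S - a * (if S \<subseteq> {..<n} \<and> card S = p then w S else 0) \<in> idl.span A"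
      using w[of S] by (auto simp: mult.commute idl.span_zero)
  qed
qed

text \<open>Since \<open>a\<close> acts as zero on homology, degree \<open>p\<close> homology over
  \<open>R/I\<close> embeds into degree \<open>p + 1\<close> homology over \<open>R/(I, a)\<close>.
  Concretely, for a cycle \<open>c\<close> the chain \<open>koszul_h b n c\<close> bounds
  \<open>a * c\<close> modulo \<open>I\<close>, so it is a cycle modulo \<open>(I, a)\<close>, hence
  a boundary plus \<open>a * w\<close>. Applying the differential shows that \<open>a * c\<close>
  and \<open>a\<close> times the boundary of \<open>w\<close> agree, and \<open>a\<close>
  cancels.\<close>

lemma koszul_exact_descend:
  assumes exact: "koszul_exact f n (idl.span (insert a A)) (Suc p)"
    and nzd: "nonzerodivisor_mod (idl.span A) a"
    and a: "a \<in> idl.span (f ` {..<n})"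
  shows "koszul_exact f n (idl.span A) p"
  unfolding koszul_exact_def
proof (intro allI impI, elim conjE)
  fix c assume c: "koszul_chain n p c" and dc: "\<forall>S. koszul_d f n c S \<in> idl.span A"
  obtain b where b: "a = (\<Sum>i<n. b i * f i)"
    using span_image_lessThan[OF a] by blast
  let ?h = "koszul_h b n c"
  have hd: "a * c S - koszul_d f n ?h S \<in> idl.span A" for S
    using koszul_homotopy[of f n b c S] koszul_h_in_ideal[of "idl.span A" "koszul_d f n c" b n S] dc
    by (simp add: b flip: koszul_homotopy[of f n b c S])
  have "koszul_d f n ?h S \<in> idl.span (insert a A)" for S
  proof -
    have "a * c S \<in> idl.span (insert a A)"
      using idl.span_scale[OF idl.span_base, of a "insert a A" "c S"] by (simp add: mult.commute)
    moreover have "a * c S - koszul_d f n ?h S \<in> idl.span (insert a A)"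
      using hd[of S] idl.span_mono[of A "insert a A"] by blast
    ultimately show ?thesis using idl.span_diff by fastforce
  qed
  then obtain e where e: "koszul_chain n (Suc (Suc p)) e"
      "\<And>S. ?h S - koszul_d f n e S \<in> idl.span (insert a A)"
    using koszul_exactE[OF exact koszul_chain_h[OF c]] by blast
  have "koszul_chain n (Suc p) (\<lambda>S. ?h S - koszul_d f n e S)"
    using koszul_chain_diff[OF koszul_chain_h[OF c] koszul_chain_d[OF e(1)], of b 1 f] by simp
  then obtain w where w: "koszul_chain n (Suc p) w"
      "\<And>S. (?h S - koszul_d f n e S) - a * w S \<in> idl.span A"
    using ideal_insert_chain e(2) by blast
  have "c S - koszul_d f n w S \<in> idl.span A" for S
  proof -
    have "koszul_d f n (\<lambda>S. (?h S - koszul_d f n e S) - a * w S) S \<in> idl.span A"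
      using w(2) by (intro koszul_d_in_ideal) auto
    then have "koszul_d f n ?h S - a * koszul_d f n w S \<in> idl.span A"
      by (simp add: koszul_d_diff koszul_d_scale koszul_d_d)
    then have "a * (c S - koszul_d f n w S) \<in> idl.span A"
      using idl.span_add[OF hd[of S]] by (fastforce simp: algebra_simps)
    then show ?thesis using nzd by (auto simp: nonzerodivisor_mod_def)
  qed
  then show "\<exists>e. koszul_chain n (Suc p) e \<and> (\<forall>S. c S - koszul_d f n e S \<in> idl.span A)"
    using w(1) by blast
qed

section \<open>Regular sequences\<close>

text \<open>Weak regularity: the ideal generated may be the whole ring. Properness is kept as a
  separate condition.\<close>

definition regular_list :: "'a::comm_ring_1 list \<Rightarrow> bool" where
  "regular_list as \<longleftrightarrow> (\<forall>i<length as. nonzerodivisor_mod (idl.span (set (take i as))) (as ! i))"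

lemma regular_list_append:
  "regular_list (as @ [a]) \<longleftrightarrow> regular_list as \<and> nonzerodivisor_mod (idl.span (set as)) a"
  by (auto simp: regular_list_def nth_append less_Suc_eq)

lemma set_take_Suc: "i < length as \<Longrightarrow> set (take (Suc i) as) = insert (as ! i) (set (take i as))"
  by (simp add: take_Suc_conv_app_nth)

text \<open>The homology vanishes above degree \<open>n\<close> since there are no chains; removing one element of
  the regular sequence at a time improves this bound by one.\<close>

lemma koszul_exact_regular:
  assumes reg: "regular_list as" and len: "length as = n"
    and sub: "set as \<subseteq> idl.span (f ` {..<n})"
    and "i \<le> n" "i < p"
  shows "koszul_exact f n (idl.span (set (take i as))) p"
  using assms(4,5)
proof (induction arbitrary: p rule: inc_induct)
  case base
  then show ?case by (simp add: koszul_exact_above)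
next
  case (step i)
  have "koszul_exact f n (idl.span (insert (as ! i) (set (take i as)))) (Suc p)"
    using step.IH[of "Suc p"] step.prems step.hyps len by (simp add: set_take_Suc)
  moreover have "nonzerodivisor_mod (idl.span (set (take i as))) (as ! i)"
    using reg step.hyps len by (simp add: regular_list_def)
  moreover have "as ! i \<in> idl.span (f ` {..<n})"
    using sub step.hyps len by (auto simp: subset_iff)
  ultimately show ?case by (rule koszul_exact_descend)
qed

text \<open>Any two homology classes of degree \<open>p\<close> over \<open>R/I\<close> are dependent over \<open>R/(f)\<close>.\<close>

definition koszul_cyclic :: "(nat \<Rightarrow> 'a::comm_ring_1) \<Rightarrow> nat \<Rightarrow> 'a set \<Rightarrow> nat \<Rightarrow> bool" where
  "koszul_cyclic f n I p \<longleftrightarrow>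
     (\<forall>u v. koszul_chain n p u \<and> koszul_chain n p v \<and>
        (\<forall>S. koszul_d f n u S \<in> I) \<and> (\<forall>S. koszul_d f n v S \<in> I) \<longrightarrow>
        (\<exists>a b e. \<not> (a \<in> idl.span (f ` {..<n}) \<and> b \<in> idl.span (f ` {..<n})) \<and>
           koszul_chain n (Suc p) e \<and> (\<forall>S. a * u S + b * v S - koszul_d f n e S \<in> I)))"

lemma koszul_chain_0_outside: "koszul_chain n 0 c \<Longrightarrow> S \<noteq> {} \<Longrightarrow> c S = 0"
  unfolding koszul_chain_def using finite_subset[of S "{..<n}"] by (metis card_0_eq finite_lessThan)

text \<open>Degree zero homology is \<open>R/(f)\<close>. Two classes \<open>u\<close>,
  \<open>v\<close> satisfy \<open>v * u - u * v = 0\<close>, which is a usable relation unless both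
  lie in the ideal; in that case \<open>u\<close> is itself a boundary and the coefficients 1 and 0
  work.\<close>

lemma koszul_cyclic_0:
  assumes "1 \<notin> idl.span (f ` {..<n})"
  shows "koszul_cyclic f n {0} 0"
  unfolding koszul_cyclic_def
proof (intro allI impI, elim conjE)
  fix u v :: "nat set \<Rightarrow> 'a" assume u: "koszul_chain n 0 u" and v: "koszul_chain n 0 v"
  let ?m = "idl.span (f ` {..<n})"
  show "\<exists>a b e. \<not> (a \<in> ?m \<and> b \<in> ?m) \<and>
           koszul_chain n (Suc 0) e \<and> (\<forall>S. a * u S + b * v S - koszul_d f n e S \<in> {0})"
  proof (cases "u {} \<in> ?m \<and> v {} \<in> ?m")
    case False
    have "- u {} \<notin> ?m" if "u {} \<notin> ?m" using that idl.span_neg[of "- u {}"] by auto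
    with False have nm: "\<not> (v {} \<in> ?m \<and> - u {} \<in> ?m)" by blast
    have "v {} * u S + - u {} * v S = 0" for S
      using koszul_chain_0_outside[OF u, of S] koszul_chain_0_outside[OF v, of S] by (cases "S = {}") auto
    moreover have "koszul_d f n (\<lambda>_. 0) S = 0" for S
      by (simp add: koszul_d_def contract_def cong: if_cong)
    moreover have "koszul_chain n (Suc 0) (\<lambda>_. 0 :: 'a)" by (simp add: koszul_chain_def)
    ultimately show ?thesis
      using nm by (intro exI[of _ "v {}"] exI[of _ "- u {}"] exI[of _ "\<lambda>_. 0"]) simp
  next
    case True
    then obtain b where b: "u {} = (\<Sum>i<n. b i * f i)" using span_image_lessThan by blast
    define e where "e S = (if S \<subseteq> {..<n} \<and> card S = 1 then b (the_elem S) else 0)" for S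
    have e: "koszul_chain n (Suc 0) e" by (auto simp: koszul_chain_def e_def split: if_splits)
    have "u S - koszul_d f n e S = 0" for S
    proof (cases "S = {}")
      case True
      have "koszul_d f n e {} = (\<Sum>i<n. b i * f i)"
        unfolding koszul_d_def by (intro sum.cong refl) (simp add: contract_def e_def koszul_sign_def)
      with True b show ?thesis by simp
    next
      case False
      then show ?thesis
        using koszul_chain_0_outside[OF u] koszul_chain_0_outside[OF koszul_chain_d[OF e]] by simp
    qed
    with e assms show ?thesis by (intro exI[of _ 1] exI[of _ 0] exI[of _ e]) simp
  qed
qed

text \<open>The connecting map sends the class of a cycle \<open>c\<close> modulo
  \<open>(I, r)\<close> to its differential divided by \<open>r\<close>, a class one degree lower
  over \<open>R/I\<close>. It is injective because homology of degree \<open>p + 1\<close> over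
  \<open>R/I\<close> vanishes, so a dependence between the images lifts back.\<close>

lemma koszul_cyclic_ascend:
  assumes cyc: "koszul_cyclic f n (idl.span A) p"
    and exact: "koszul_exact f n (idl.span A) (Suc p)"
    and nzd: "nonzerodivisor_mod (idl.span A) r"
  shows "koszul_cyclic f n (idl.span (insert r A)) (Suc p)"
  unfolding koszul_cyclic_def
proof (intro allI impI, elim conjE)
  have lift: "\<exists>w. koszul_chain n p w \<and> (\<forall>S. koszul_d f n c S - r * w S \<in> idl.span A) \<and>
      (\<forall>S. koszul_d f n w S \<in> idl.span A)"
    if c: "koszul_chain n (Suc p) c" "\<forall>S. koszul_d f n c S \<in> idl.span (insert r A)" for c
  proof -
    obtain w where w: "koszul_chain n p w" "\<And>S. koszul_d f n c S - r * w S \<in> idl.span A"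
      using ideal_insert_chain[OF koszul_chain_d[OF c(1)]] c(2) by blast
    have "koszul_d f n w S \<in> idl.span A" for S
    proof -
      have "koszul_d f n (\<lambda>S. koszul_d f n c S - r * w S) S \<in> idl.span A"
        using w(2) by (intro koszul_d_in_ideal) auto
      then have "- (r * koszul_d f n w S) \<in> idl.span A"
        by (simp add: koszul_d_diff koszul_d_scale koszul_d_d)
      then have "r * koszul_d f n w S \<in> idl.span A" using idl.span_neg by fastforce
      then show ?thesis using nzd by (auto simp: nonzerodivisor_mod_def)
    qed
    with w show ?thesis by blast
  qed
  fix u v :: "nat set \<Rightarrow> 'a"
  assume u: "koszul_chain n (Suc p) u" "\<forall>S. koszul_d f n u S \<in> idl.span (insert r A)"
    and v: "koszul_chain n (Suc p) v" "\<forall>S. koszul_d f n v S \<in> idl.span (insert r A)"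
  obtain u' where u': "koszul_chain n p u'" "\<And>S. koszul_d f n u S - r * u' S \<in> idl.span A"
    "\<forall>S. koszul_d f n u' S \<in> idl.span A" using lift[OF u] by blast
  obtain v' where v': "koszul_chain n p v'" "\<And>S. koszul_d f n v S - r * v' S \<in> idl.span A"
    "\<forall>S. koszul_d f n v' S \<in> idl.span A" using lift[OF v] by blast
  obtain a b e where ab: "\<not> (a \<in> idl.span (f ` {..<n}) \<and> b \<in> idl.span (f ` {..<n}))"
    and e: "koszul_chain n (Suc p) e" "\<And>S. a * u' S + b * v' S - koszul_d f n e S \<in> idl.span A"
    using cyc u'(1,3) v'(1,3) unfolding koszul_cyclic_def by blast
  \<comment> \<open>Subtracting \<open>r * e\<close> is harmless modulo \<open>r\<close> and turns
    the combination of \<open>u\<close> and \<open>v\<close> into a cycle modulo the smaller ideal,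
    where exactness is available.\<close>
  let ?w = "\<lambda>S. (a * u S + b * v S) - r * e S"
  have "koszul_d f n ?w S \<in> idl.span A" for S
  proof -
    have "a * (koszul_d f n u S - r * u' S) + b * (koszul_d f n v S - r * v' S)
        + r * (a * u' S + b * v' S - koszul_d f n e S) \<in> idl.span A"
      by (intro idl.span_add idl.span_scale u'(2) v'(2) e(2))
    then show ?thesis by (simp add: koszul_d_diff koszul_d_scale koszul_d_combine algebra_simps)
  qed
  moreover have "koszul_chain n (Suc p) ?w"
    by (intro koszul_chain_diff koszul_chain_combine u v e)
  ultimately obtain e' where e': "koszul_chain n (Suc (Suc p)) e'"
      "\<And>S. ?w S - koszul_d f n e' S \<in> idl.span A"
    using koszul_exactE[OF exact] by blast
  have "a * u S + b * v S - koszul_d f n e' S \<in> idl.span (insert r A)" for S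
  proof -
    have "?w S - koszul_d f n e' S \<in> idl.span (insert r A)"
      using e'(2)[of S] idl.span_mono[of A "insert r A"] by blast
    moreover have "e S * r \<in> idl.span (insert r A)" by (intro idl.span_scale idl.span_base) simp
    ultimately have "(?w S - koszul_d f n e' S) + e S * r \<in> idl.span (insert r A)"
      by (rule idl.span_add)
    then show ?thesis by (simp add: algebra_simps)
  qed
  with ab e'(1) show "\<exists>a b e. \<not> (a \<in> idl.span (f ` {..<n}) \<and> b \<in> idl.span (f ` {..<n})) \<and>
      koszul_chain n (Suc (Suc p)) e \<and>
      (\<forall>S. a * u S + b * v S - koszul_d f n e S \<in> idl.span (insert r A))"
    by blast
qed

text \<open>The index doubles as the homological degree: each entry of the regular sequence raises
  both by one. Exactness is then needed only in degree \<open>i + 1\<close> modulo \<open>i\<close>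
  entries, just above the bound of \<open>koszul_exact_regular\<close>.\<close>

lemma koszul_cyclic_regular:
  assumes reg: "regular_list as" and len: "length as = n"
    and sub: "set as \<subseteq> idl.span (f ` {..<n})" and one: "1 \<notin> idl.span (f ` {..<n})"
  shows "i \<le> n \<Longrightarrow> koszul_cyclic f n (idl.span (set (take i as))) i"
proof (induction i)
  case 0
  then show ?case using koszul_cyclic_0[OF one] by simp
next
  case (Suc i)
  have "koszul_exact f n (idl.span (set (take i as))) (Suc i)"
    using Suc.prems by (intro koszul_exact_regular[OF reg len sub]) auto
  moreover have "nonzerodivisor_mod (idl.span (set (take i as))) (as ! i)"
    using reg Suc.prems len by (simp add: regular_list_def)
  ultimately show ?case
    using koszul_cyclic_ascend Suc len by (simp add: set_take_Suc)
qed

text \<open>The socle modulo a regular sequence is the top Koszul homology.\<close>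

lemma socle_cyclic:
  assumes reg: "regular_list as" and len: "length as = n"
    and sub: "set as \<subseteq> idl.span (f ` {..<n})" and one: "1 \<notin> idl.span (f ` {..<n})"
    and u: "\<And>i. i < n \<Longrightarrow> f i * u \<in> idl.span (set as)"
    and v: "\<And>i. i < n \<Longrightarrow> f i * v \<in> idl.span (set as)"
  obtains a b where "\<not> (a \<in> idl.span (f ` {..<n}) \<and> b \<in> idl.span (f ` {..<n}))"
    "a * u + b * v \<in> idl.span (set as)"
proof -
  let ?top = "\<lambda>x S. if S = {..<n} then x else (0::'a)"
  have chain: "koszul_chain n n (?top x)" for x by (simp add: koszul_chain_def)
  have cycle: "koszul_d f n (?top x) S \<in> idl.span (set as)"
    if x: "\<And>i. i < n \<Longrightarrow> f i * x \<in> idl.span (set as)" for x S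
    unfolding koszul_d_def
  proof (rule idl.span_sum)
    fix i assume "i \<in> {..<n}"
    then have "koszul_sign i S * (f i * x) \<in> idl.span (set as)" by (intro idl.span_scale x) simp
    then show "f i * contract i (?top x) S \<in> idl.span (set as)"
      by (simp add: contract_def idl.span_zero algebra_simps)
  qed
  obtain a b e where ab: "\<not> (a \<in> idl.span (f ` {..<n}) \<and> b \<in> idl.span (f ` {..<n}))"
    and e: "koszul_chain n (Suc n) e"
      "\<And>S. a * ?top u S + b * ?top v S - koszul_d f n e S \<in> idl.span (set as)"
    using koszul_cyclic_regular[OF reg len sub one, of n] chain[of u] chain[of v] cycle[OF u] cycle[OF v]
    unfolding koszul_cyclic_def by (simp add: len) blast
  \<comment> \<open>There are no chains of degree \<open>n + 1\<close>, hence no boundaries in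
    degree \<open>n\<close>, and the dependence of classes becomes one of \<open>u\<close> and
    \<open>v\<close> modulo the ideal.\<close>
  have "e = (\<lambda>_. 0)" using koszul_chain_above[OF e(1)] by auto
  then have "koszul_d f n e S = 0" for S by (simp add: koszul_d_def contract_def cong: if_cong)
  with e(2)[of "{..<n}"] have "a * u + b * v \<in> idl.span (set as)" by simp
  with ab that show thesis by blast
qed

text \<open>The matrix \<open>e\<close> is alternating, so \<open>c\<close> is a combination of the
  relations expressing \<open>f i * f j = f j * f i\<close>. The zero diagonal is what later puts
  the last coefficient of a relation into the ideal of the earlier entries.\<close>

definition trivial_relations :: "(nat \<Rightarrow> 'a::comm_ring_1) \<Rightarrow> nat \<Rightarrow> (nat \<Rightarrow> 'a) \<Rightarrow> bool" where
  "trivial_relations f n c \<longleftrightarrow> (\<exists>e. (\<forall>i j. e i j + e j i = 0) \<and> (\<forall>i. e i i = 0) \<and>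
     (\<forall>i<n. c i = (\<Sum>j<n. e i j * f j)))"

lemma koszul_exact_imp_trivial_relations:
  assumes exact: "koszul_exact f n {0} 1" and c: "(\<Sum>i<n. c i * f i) = 0"
  shows "trivial_relations f n c"
proof -
  define u where "u S = (if S \<subseteq> {..<n} \<and> card S = 1 then c (the_elem S) else 0)" for S
  have u: "koszul_chain n (Suc 0) u" by (auto simp: koszul_chain_def u_def split: if_splits)
  have "koszul_d f n u S = 0" for S
  proof (cases "S = {}")
    case True
    have "koszul_d f n u {} = (\<Sum>i<n. c i * f i)"
      unfolding koszul_d_def by (intro sum.cong refl) (simp add: contract_def u_def koszul_sign_def)
    with True c show ?thesis by simp
  next
    case False
    then show ?thesis using koszul_chain_0_outside[OF koszul_chain_d[OF u]] by simp
  qed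
  then obtain w where w: "\<And>S. u S = koszul_d f n w S"
    using koszul_exactE[OF exact, of u thesis] u by simp
  \<comment> \<open>A two-chain has one coefficient per pair; the Koszul sign spreads it over both
    orders of the pair as an alternating matrix.\<close>
  define e where "e i j = (if i = j then 0 else koszul_sign j {i} * w {i, j})" for i j
  have sgn: "(koszul_sign j {i} :: 'a) = (if i < j then - 1 else 1)" for i j
  proof -
    have "(koszul_sign j {} :: 'a) = 1" by (simp add: koszul_sign_def)
    then show ?thesis using koszul_sign_insert[of i "{}" j, where ?'a = 'a] by simp
  qed
  have "c i = (\<Sum>j<n. e i j * f j)" if "i < n" for i
  proof -
    have "c i = koszul_d f n w {i}" using that w[of "{i}"] by (simp add: u_def)
    also have "\<dots> = (\<Sum>j<n. e i j * f j)"
      unfolding koszul_d_def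
      by (intro sum.cong refl) (auto simp: contract_def e_def insert_commute)
    finally show ?thesis .
  qed
  moreover have "e i j + e j i = 0" for i j
    by (cases i j rule: linorder_cases) (auto simp: e_def sgn insert_commute)
  moreover have "e i i = 0" for i by (simp add: e_def)
  ultimately show ?thesis unfolding trivial_relations_def by blast
qed

section \<open>Polynomials\<close>

abbreviation coeff :: "('n, 'k::field_char_0) mpoly \<Rightarrow> ('n \<Rightarrow>\<^sub>0 nat) \<Rightarrow> 'k" where
  "coeff \<equiv> Poly_Mapping.lookup"

abbreviation monom :: "('n \<Rightarrow>\<^sub>0 nat) \<Rightarrow> 'k \<Rightarrow> ('n, 'k::field_char_0) mpoly" where
  "monom \<equiv> Poly_Mapping.single"

definition mdeg :: "('n::finite \<Rightarrow>\<^sub>0 nat) \<Rightarrow> nat" where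
  "mdeg m = (\<Sum>i\<in>UNIV. Poly_Mapping.lookup m i)"

lemma mdeg_add: "mdeg (a + b) = mdeg a + mdeg b"
  by (simp add: mdeg_def lookup_add sum.distrib)

lemma mdeg_single: "mdeg (Poly_Mapping.single i k) = k"
  by (simp add: mdeg_def lookup_single when_def)

lemma const_0: "const 0 = 0" and const_1: "const 1 = 1"
  and const_add: "const (a + b) = const a + const b"
  and const_mult: "const (a * b) = const a * const b"
  by (simp_all add: const_def single_add mult_single)

lemma coeff_const_mult: "coeff (const c * f) m = c * coeff f m"
  by (simp add: const_def flip: mult_map_scale_conv_mult)
     (simp add: Poly_Mapping.map.rep_eq when_def in_keys_iff)

interpretation vs: vector_space "\<lambda>(c::'k::field_char_0) (f::('n, 'k) mpoly). const c * f"
  by unfold_locales (simp_all add: algebra_simps const_add const_mult const_1)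

declare vs.scale_scale [simp del]

lemma mpoly_expand: "f = (\<Sum>m\<in>Poly_Mapping.keys f. monom m (coeff f m))"
proof (rule poly_mapping_eqI)
  fix k
  have "(\<Sum>m\<in>Poly_Mapping.keys f. coeff f m when m = k) = coeff f k"
    by (simp add: when_def in_keys_iff)
  then show "coeff f k = coeff (\<Sum>m\<in>Poly_Mapping.keys f. monom m (coeff f m)) k"
    by (simp add: lookup_sum lookup_single)
qed

lemma monom_eq: "monom m c = const c * monom m 1"
  by (simp add: const_def mult_single)

definition restrict :: "(('n \<Rightarrow>\<^sub>0 nat) \<Rightarrow> bool) \<Rightarrow> ('n, 'k::field_char_0) mpoly \<Rightarrow> ('n, 'k) mpoly" where
  "restrict P f = Poly_Mapping.mapp (\<lambda>m c. c when P m) f"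

lemma coeff_restrict: "coeff (restrict P f) m = (coeff f m when P m)"
  by (simp add: restrict_def lookup_mapp when_def in_keys_iff)

lemma keys_restrict: "Poly_Mapping.keys (restrict P f) = {m\<in>Poly_Mapping.keys f. P m}"
  by (auto simp: in_keys_iff coeff_restrict)

lemma restrict_add: "restrict P (f + g) = restrict P f + restrict P g"
  by (rule poly_mapping_eqI) (simp add: coeff_restrict lookup_add when_add_distrib)

lemma restrict_0: "restrict P 0 = 0"
  by (rule poly_mapping_eqI) (simp add: coeff_restrict)

lemma restrict_sum: "restrict P (\<Sum>i\<in>A. f i) = (\<Sum>i\<in>A. restrict P (f i))"
  by (induction A rule: infinite_finite_induct) (simp_all add: restrict_add restrict_0)

lemma restrict_id: "(\<And>m. m \<in> Poly_Mapping.keys f \<Longrightarrow> P m) \<Longrightarrow> restrict P f = f"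
  by (rule poly_mapping_eqI) (auto simp: coeff_restrict when_def in_keys_iff)

lemma restrict_none: "(\<And>m. m \<in> Poly_Mapping.keys f \<Longrightarrow> \<not> P m) \<Longrightarrow> restrict P f = 0"
  by (rule poly_mapping_eqI) (auto simp: coeff_restrict when_def in_keys_iff)

lemma restrict_split: "f = restrict P f + restrict (\<lambda>m. \<not> P m) f"
  by (rule poly_mapping_eqI) (simp add: coeff_restrict lookup_add when_def)

text \<open>For homogeneous \<open>g\<close>, a degree condition on a product is a shifted degree
  condition on the other factor. This is how degree truncations pass through products.\<close>

lemma restrict_mult:
  assumes "\<And>a b. b \<in> Poly_Mapping.keys g \<Longrightarrow> P (a + b) \<longleftrightarrow> Q a"
  shows "restrict P (f * g) = restrict Q f * g"
proof -
  have "restrict P (f * g) = restrict P (restrict Q f * g) + restrict P (restrict (\<lambda>m. \<not> Q m) f * g)"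
    by (subst restrict_split[of f Q]) (simp add: distrib_right restrict_add)
  moreover have "restrict P (restrict Q f * g) = restrict Q f * g"
    using keys_mult[of "restrict Q f" g] assms by (intro restrict_id) (auto simp: keys_restrict)
  moreover have "restrict P (restrict (\<lambda>m. \<not> Q m) f * g) = 0"
    using keys_mult[of "restrict (\<lambda>m. \<not> Q m) f" g] assms
    by (intro restrict_none) (auto simp: keys_restrict)
  ultimately show ?thesis by simp
qed

section \<open>Homogeneous polynomials and homogeneous parts\<close>

lemma homogeneous_component_iff:
  "f \<in> homogeneous_component d \<longleftrightarrow> (\<forall>m\<in>Poly_Mapping.keys f. mdeg m = d)"
  by (simp add: homogeneous_component_def mdeg_def)

lemma homogeneous_coeff: "f \<in> homogeneous_component d \<longleftrightarrow> (\<forall>m. mdeg m \<noteq> d \<longrightarrow> coeff f m = 0)"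
  by (auto simp: homogeneous_component_iff in_keys_iff)

lemma subspace_homogeneous_component: "vs.subspace (homogeneous_component d)"
  by (rule vs.subspaceI) (auto simp: homogeneous_coeff lookup_add coeff_const_mult)

lemma homogeneous_mult:
  "f \<in> homogeneous_component d \<Longrightarrow> g \<in> homogeneous_component e \<Longrightarrow>
    f * g \<in> homogeneous_component (d + e)"
  using keys_mult[of f g] by (fastforce simp: homogeneous_component_iff mdeg_add)

lemma homogeneous_monom: "monom m c \<in> homogeneous_component (mdeg m)"
  by (simp add: homogeneous_component_iff)

abbreviation hom_part :: "nat \<Rightarrow> ('n::finite, 'k::field_char_0) mpoly \<Rightarrow> ('n, 'k) mpoly" where
  "hom_part d \<equiv> restrict (\<lambda>m. mdeg m = d)"

lemma hom_part_in: "hom_part d f \<in> homogeneous_component d"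
  by (simp add: homogeneous_component_iff keys_restrict)

lemma hom_part_id: "f \<in> homogeneous_component d \<Longrightarrow> hom_part d f = f"
  by (intro restrict_id) (simp add: homogeneous_component_iff)

lemma hom_part_mult:
  assumes "g \<in> homogeneous_component e"
  shows "hom_part d (f * g) = (if e \<le> d then hom_part (d - e) f * g else 0)"
proof -
  have "hom_part d (f * g) = restrict (\<lambda>m. mdeg m + e = d) f * g"
    using assms by (intro restrict_mult) (auto simp: homogeneous_component_iff mdeg_add)
  moreover have "(\<lambda>m::'a \<Rightarrow>\<^sub>0 nat. mdeg m + e = d) = (\<lambda>m. mdeg m = d - e)" if "e \<le> d"
    using that by (auto simp: fun_eq_iff)
  moreover have "restrict (\<lambda>m. mdeg m + e = d) f = 0" if "\<not> e \<le> d"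
    using that by (intro restrict_none) auto
  ultimately show ?thesis by simp
qed

lemma hom_part_ideal:
  assumes "\<And>g. g \<in> A \<Longrightarrow> \<exists>e. g \<in> homogeneous_component e" "f \<in> idl.span A"
  shows "hom_part d f \<in> idl.span A"
  using assms(2)
proof (induction rule: idl.span_induct_alt)
  case base
  then show ?case by (simp add: restrict_0 idl.span_zero)
next
  case (step c x y)
  obtain e where "x \<in> homogeneous_component e" using assms(1) step by blast
  then have "hom_part d (c * x) \<in> idl.span A"
    using step by (simp add: hom_part_mult idl.span_scale idl.span_base idl.span_zero)
  with step show ?case by (simp add: restrict_add idl.span_add)
qed

lemma sum_hom_parts: "f = (\<Sum>d\<in>mdeg ` Poly_Mapping.keys f. hom_part d f)"
proof (rule poly_mapping_eqI)
  fix m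
  have "(\<Sum>d\<in>mdeg ` Poly_Mapping.keys f. coeff f m when mdeg m = d) = coeff f m"
    by (auto simp: when_def in_keys_iff)
  then show "coeff f m = coeff (\<Sum>d\<in>mdeg ` Poly_Mapping.keys f. hom_part d f) m"
    by (simp add: lookup_sum coeff_restrict)
qed

section \<open>The annihilator\<close>

text \<open>Multiplying the coefficients of \<open>F\<close> by the factorials of the exponents turns differentiation
  into contraction.\<close>

definition factorials :: "('n::finite \<Rightarrow>\<^sub>0 nat) \<Rightarrow> 'k::field_char_0" where
  "factorials m = (\<Prod>i\<in>UNIV. fact (Poly_Mapping.lookup m i))"

definition divided_coeff :: "('n::finite, 'k::field_char_0) mpoly \<Rightarrow> ('n \<Rightarrow>\<^sub>0 nat) \<Rightarrow> 'k" where
  "divided_coeff F m = factorials m * coeff F m"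

lemma factorials_neq_0: "factorials m \<noteq> 0"
  by (simp add: factorials_def)

lemma divided_coeff_inject: "(\<And>m. divided_coeff F m = divided_coeff G m) \<Longrightarrow> F = G"
  by (rule poly_mapping_eqI) (simp add: divided_coeff_def factorials_neq_0)

lemma divided_coeff_const_mult: "divided_coeff (const c * f) a = c * divided_coeff f a"
  by (simp add: divided_coeff_def coeff_const_mult mult.left_commute)

lemma divided_coeff_sum: "divided_coeff (\<Sum>i\<in>A. f i) a = (\<Sum>i\<in>A. divided_coeff (f i) a)"
  by (simp add: divided_coeff_def lookup_sum sum_distrib_left)

lemma factorials_add_single:
  "factorials (a + Poly_Mapping.single i 1) = of_nat (Poly_Mapping.lookup a i + 1) * factorials a"
proof -
  let ?P = "\<Prod>j\<in>UNIV - {i}. fact (Poly_Mapping.lookup a j)"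
  have "factorials (a + Poly_Mapping.single i 1) = fact (Poly_Mapping.lookup a i + 1) * ?P"
    unfolding factorials_def
    by (subst prod.remove[of _ i]) (simp_all add: lookup_add lookup_single when_def)
  also have "\<dots> = of_nat (Poly_Mapping.lookup a i + 1) * (fact (Poly_Mapping.lookup a i) * ?P)"
    by (simp add: algebra_simps)
  also have "fact (Poly_Mapping.lookup a i) * ?P = factorials a"
    unfolding factorials_def by (subst prod.remove[of _ i]) simp_all
  finally show ?thesis .
qed

lemma coeff_partial_deriv:
  "coeff (partial_deriv i F) a = of_nat (Poly_Mapping.lookup a i + 1) * coeff F (a + Poly_Mapping.single i 1)"
proof -
  let ?e = "Poly_Mapping.single i (1::nat)"
  have "(of_nat (Poly_Mapping.lookup m i) * coeff F m when m - ?e = a)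
      = (if m = a + ?e then of_nat (Poly_Mapping.lookup a i + 1) * coeff F (a + ?e) else 0)" for m
  proof (cases "Poly_Mapping.lookup m i = 0")
    case True
    then have "m \<noteq> a + ?e" by (auto simp: lookup_add)
    with True show ?thesis by simp
  next
    case False
    then have "m - ?e + ?e = m"
      by (intro poly_mapping_eqI) (auto simp: lookup_add lookup_minus lookup_single when_def)
    then have "m - ?e = a \<longleftrightarrow> m = a + ?e" by auto
    then show ?thesis by (auto simp: lookup_add)
  qed
  then show ?thesis
    by (auto simp: partial_deriv_def lookup_sum lookup_single in_keys_iff)
qed

lemma divided_coeff_partial_deriv:
  "divided_coeff (partial_deriv i F) a = divided_coeff F (a + Poly_Mapping.single i 1)"
  by (simp add: divided_coeff_def coeff_partial_deriv factorials_add_single del: One_nat_def)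

lemma divided_coeff_partial_deriv_power:
  "divided_coeff ((partial_deriv i ^^ k) F) a = divided_coeff F (a + Poly_Mapping.single i k)"
proof (induction k arbitrary: a)
  case (Suc k)
  have "Poly_Mapping.single i (1::nat) + Poly_Mapping.single i k = Poly_Mapping.single i (Suc k)"
    by (simp flip: single_add)
  then show ?case
    by (simp add: divided_coeff_partial_deriv Suc add.assoc del: One_nat_def)
qed simp

lemma divided_coeff_monomial_deriv:
  fixes F :: "('n::finite, 'k::field_char_0) mpoly"
  shows "divided_coeff (monomial_deriv m F) a = divided_coeff F (a + m)"
proof -
  let ?f = "\<lambda>i. partial_deriv i ^^ Poly_Mapping.lookup m i"
  \<comment> \<open>On divided coefficients the operators are shifts of exponent vectors, so they
    commute because addition of exponents does.\<close>
  interpret comp_fun_commute "?f :: 'n \<Rightarrow> ('n, 'k) mpoly \<Rightarrow> _"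
  proof
    fix i j
    show "?f i \<circ> ?f j = ?f j \<circ> (?f i :: ('n, 'k) mpoly \<Rightarrow> _)"
      by (rule ext, rule divided_coeff_inject)
        (simp add: divided_coeff_partial_deriv_power add.assoc add.commute add.left_commute)
  qed
  have "finite A \<Longrightarrow> divided_coeff (Finite_Set.fold ?f F A) a
      = divided_coeff F (a + (\<Sum>i\<in>A. Poly_Mapping.single i (Poly_Mapping.lookup m i)))" for A
    by (induction A arbitrary: a rule: finite_induct)
      (simp_all add: divided_coeff_partial_deriv_power add.assoc)
  moreover have "(\<Sum>i\<in>UNIV. Poly_Mapping.single i (Poly_Mapping.lookup m i)) = m"
    by (rule poly_mapping_eqI) (simp add: lookup_sum lookup_single when_def)
  ultimately show ?thesis by (simp add: monomial_deriv_def)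
qed

text \<open>The constant term of \<open>diff_action f F\<close>, that is, the apolarity pairing of
  \<open>f\<close> with \<open>F\<close>.\<close>

definition dual :: "('n::finite, 'k::field_char_0) mpoly \<Rightarrow> ('n, 'k) mpoly \<Rightarrow> 'k" where
  "dual F f = (\<Sum>m\<in>Poly_Mapping.keys f. coeff f m * divided_coeff F m)"

lemma dual_superset:
  assumes "finite S" "Poly_Mapping.keys f \<subseteq> S"
  shows "dual F f = (\<Sum>m\<in>S. coeff f m * divided_coeff F m)"
  unfolding dual_def using assms by (intro sum.mono_neutral_left) (auto simp: in_keys_iff)

lemma dual_add: "dual F (f + g) = dual F f + dual F g"
  using keys_add[of f g]
  by (simp add: dual_superset[of "Poly_Mapping.keys f \<union> Poly_Mapping.keys g"]
      lookup_add distrib_right sum.distrib)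

lemma dual_const_mult: "dual F (const c * f) = c * dual F f"
proof -
  have "Poly_Mapping.keys (const c * f) \<subseteq> Poly_Mapping.keys f"
    by (auto simp: in_keys_iff coeff_const_mult)
  then have "dual F (const c * f) = (\<Sum>m\<in>Poly_Mapping.keys f. coeff (const c * f) m * divided_coeff F m)"
    by (intro dual_superset) simp_all
  then show ?thesis by (simp add: coeff_const_mult dual_def sum_distrib_left mult.assoc)
qed

lemma dual_0: "dual F 0 = 0" by (simp add: dual_def)

lemma dual_sum: "dual F (\<Sum>i\<in>A. f i) = (\<Sum>i\<in>A. dual F (f i))"
  by (induction A rule: infinite_finite_induct) (simp_all add: dual_add dual_0)

lemma dual_monom: "dual F (monom m c) = c * divided_coeff F m"
  using dual_superset[of "{m}" "monom m c" F] by simp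

lemma divided_coeff_diff_action: "divided_coeff (diff_action f F) a = dual F (monom a 1 * f)"
proof -
  have "dual F (monom a 1 * f) = dual F (\<Sum>m\<in>Poly_Mapping.keys f. monom (a + m) (coeff f m))"
    by (subst mpoly_expand[of f]) (simp add: sum_distrib_left mult_single)
  also have "\<dots> = (\<Sum>m\<in>Poly_Mapping.keys f. coeff f m * divided_coeff F (a + m))"
    by (simp add: dual_sum dual_monom)
  also have "\<dots> = (\<Sum>m\<in>Poly_Mapping.keys f. coeff f m * divided_coeff (monomial_deriv m F) a)"
    by (simp add: divided_coeff_monomial_deriv)
  also have "\<dots> = divided_coeff (diff_action f F) a"
    by (simp add: diff_action_def divided_coeff_sum divided_coeff_const_mult)
  finally show ?thesis by simp
qed

text \<open>The remaining coefficients of \<open>diff_action f F\<close> are, up to nonzero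
  factorials, the pairings of \<open>F\<close> with monomial multiples of \<open>f\<close>. Thus the
  annihilator is the largest ideal inside the kernel of \<open>dual F\<close>.\<close>

lemma Ann_iff: "f \<in> Ann F \<longleftrightarrow> (\<forall>g. dual F (g * f) = 0)"
proof -
  have "f \<in> Ann F \<longleftrightarrow> (\<forall>a. divided_coeff (diff_action f F) a = 0)"
    using divided_coeff_inject[of "diff_action f F" 0] by (auto simp: Ann_def divided_coeff_def)
  also have "\<dots> \<longleftrightarrow> (\<forall>a. dual F (monom a 1 * f) = 0)"
    by (simp add: divided_coeff_diff_action)
  also have "\<dots> \<longleftrightarrow> (\<forall>g. dual F (g * f) = 0)"
  proof (intro iffI allI)
    fix g assume *: "\<forall>a. dual F (monom a 1 * f) = 0"
    have "dual F (g * f) = (\<Sum>a\<in>Poly_Mapping.keys g. dual F (const (coeff g a) * (monom a 1 * f)))"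
      by (subst mpoly_expand[of g], subst monom_eq)
        (simp add: sum_distrib_right dual_sum mult.assoc)
    also have "\<dots> = 0" using * by (simp add: dual_const_mult)
    finally show "dual F (g * f) = 0" .
  qed simp
  finally show ?thesis .
qed

lemma Ann_ideal: "idl.subspace (Ann F)"
proof (rule idl.subspaceI)
  show "c * x \<in> Ann F" if "x \<in> Ann F" for c x
  proof -
    have "dual F (g * c * x) = 0" for g using that Ann_iff by blast
    then show ?thesis by (simp add: Ann_iff mult.assoc)
  qed
qed (simp_all add: Ann_iff distrib_left dual_add dual_0)

lemma dual_homogeneous:
  assumes "F \<in> homogeneous_component n" "\<And>m. m \<in> Poly_Mapping.keys f \<Longrightarrow> mdeg m \<noteq> n"
  shows "dual F f = 0"
  unfolding dual_def using assms
  by (intro sum.neutral) (auto simp: divided_coeff_def homogeneous_coeff)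

lemma Ann_above:
  assumes "F \<in> homogeneous_component n" "f \<in> homogeneous_component d" "n < d"
  shows "f \<in> Ann F"
  unfolding Ann_iff
proof
  fix g
  show "dual F (g * f) = 0"
    using keys_mult[of g f] assms
    by (intro dual_homogeneous[of F n]) (auto simp: homogeneous_component_iff mdeg_add)
qed

lemma Ann_degree_not_all:
  assumes "F \<in> homogeneous_component n" "F \<noteq> 0"
  obtains m where "mdeg m = n" "monom m 1 \<notin> Ann F"
proof -
  obtain m where m: "m \<in> Poly_Mapping.keys F" using assms(2) by (metis keys_eq_empty ex_in_conv)
  then have "dual F (1 * monom m 1) \<noteq> 0"
    by (simp add: dual_monom divided_coeff_def factorials_neq_0 in_keys_iff)
  then have "monom m 1 \<notin> Ann F" unfolding Ann_iff by blast
  with m assms(1) that show thesis by (auto simp: homogeneous_component_iff)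
qed

lemma mdeg_eq_1:
  assumes "mdeg m = 1" obtains i where "m = Poly_Mapping.single i 1"
proof -
  obtain i where i: "Poly_Mapping.lookup m i \<noteq> 0"
    using assms unfolding mdeg_def by fastforce
  have "Poly_Mapping.lookup m i + (\<Sum>j\<in>UNIV - {i}. Poly_Mapping.lookup m j) = 1"
    using assms unfolding mdeg_def by (subst (asm) sum.remove[of _ i]) auto
  with i have *: "Poly_Mapping.lookup m i = 1" "(\<Sum>j\<in>UNIV - {i}. Poly_Mapping.lookup m j) = 0"
    by linarith+
  then have "Poly_Mapping.lookup m j = 0" if "j \<noteq> i" for j using that by simp
  with * have "m = Poly_Mapping.single i 1"
    by (intro poly_mapping_eqI) (auto simp: lookup_single when_def)
  then show thesis by (rule that)
qed

text \<open>A linear form acts on \<open>F\<close> as the same linear combination of the partial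
  derivatives, so its coefficients form a linear relation between them.\<close>

lemma Ann_linear_forms:
  assumes "\<forall>c :: 'n::finite \<Rightarrow> 'k::field_char_0.
      (\<Sum>i\<in>UNIV. const (c i) * partial_deriv i F) = 0 \<longrightarrow> (\<forall>i. c i = 0)"
    and f: "f \<in> Ann F" "f \<in> homogeneous_component 1"
  shows "f = 0"
proof -
  let ?c = "\<lambda>i. coeff f (Poly_Mapping.single i 1)"
  have f_eq: "f = (\<Sum>i\<in>UNIV. monom (Poly_Mapping.single i 1) (?c i))"
  proof (rule poly_mapping_eqI)
    fix m
    have inj: "Poly_Mapping.single i (1::nat) = Poly_Mapping.single j 1 \<longleftrightarrow> i = j" for i j :: 'n
      by (metis lookup_single_eq lookup_single_not_eq one_neq_zero)
    show "coeff f m = coeff (\<Sum>i\<in>UNIV. monom (Poly_Mapping.single i 1) (?c i)) m"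
    proof (cases "mdeg m = 1")
      case True
      then obtain i where "m = Poly_Mapping.single i 1" by (rule mdeg_eq_1)
      then show ?thesis by (simp add: lookup_sum lookup_single when_def inj del: One_nat_def)
    next
      case False
      then have "Poly_Mapping.single i 1 \<noteq> m" for i using mdeg_single by blast
      with False f(2) show ?thesis
        by (simp add: lookup_sum lookup_single homogeneous_coeff del: One_nat_def)
    qed
  qed
  have "(\<Sum>i\<in>UNIV. const (?c i) * partial_deriv i F) = 0"
  proof (rule divided_coeff_inject)
    fix a
    have "divided_coeff (\<Sum>i\<in>UNIV. const (?c i) * partial_deriv i F) a
        = (\<Sum>i\<in>UNIV. ?c i * divided_coeff (partial_deriv i F) a)"
      by (simp add: divided_coeff_sum divided_coeff_const_mult)
    also have "\<dots> = dual F (monom a 1 * f)"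
      by (subst (2) f_eq)
        (simp add: divided_coeff_partial_deriv sum_distrib_left mult_single dual_sum dual_monom
          del: One_nat_def)
    also have "\<dots> = 0" using f(1) by (simp add: Ann_iff)
    finally show "divided_coeff (\<Sum>i\<in>UNIV. const (?c i) * partial_deriv i F) a = divided_coeff 0 a"
      by (simp add: divided_coeff_def)
  qed
  then have "?c i = 0" for i using assms(1)[THEN spec, of ?c] by blast
  with f_eq show ?thesis by simp
qed

section \<open>Powers of the variables\<close>

definition var_power :: "nat \<Rightarrow> 'n \<Rightarrow> ('n, 'k::field_char_0) mpoly" where
  "var_power N i = monom (Poly_Mapping.single i N) 1"

lemma coeff_monom_mult: "coeff (monom a 1 * g) (a + m) = coeff g m"
proof -
  have "coeff (monom a 1 * g) (a + m) = coeff (\<Sum>k\<in>Poly_Mapping.keys g. monom (a + k) (coeff g k)) (a + m)"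
    by (subst mpoly_expand[of g]) (simp add: sum_distrib_left mult_single)
  also have "\<dots> = (\<Sum>k\<in>Poly_Mapping.keys g. if k = m then coeff g k else 0)"
    by (simp add: lookup_sum lookup_single when_def)
  also have "\<dots> = coeff g m" by (simp add: in_keys_iff)
  finally show ?thesis .
qed

text \<open>Membership in a monomial ideal is decided monomial by monomial. Regularity of the powers
  then reduces to the fact that multiplying by a power of one variable leaves the exponents of the
  others unchanged.\<close>

lemma span_var_powers:
  "f \<in> idl.span (var_power N ` A) \<longleftrightarrow>
    (\<forall>m\<in>Poly_Mapping.keys f. \<exists>i\<in>A. N \<le> Poly_Mapping.lookup m i)"
proof
  let ?P = "\<lambda>f :: ('a, 'b) mpoly. \<forall>m\<in>Poly_Mapping.keys f. \<exists>i\<in>A. N \<le> Poly_Mapping.lookup m i"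
  assume "f \<in> idl.span (var_power N ` A)"
  then show "?P f"
  proof (induction rule: idl.span_induct_alt)
    case (step c x y)
    then obtain i where i: "i \<in> A" "x = var_power N i" by auto
    show ?case
    proof
      fix m assume "m \<in> Poly_Mapping.keys (c * x + y)"
      then have "m \<in> Poly_Mapping.keys (c * x) \<or> m \<in> Poly_Mapping.keys y"
        using keys_add[of "c * x" y] by auto
      then show "\<exists>i\<in>A. N \<le> Poly_Mapping.lookup m i"
      proof
        assume "m \<in> Poly_Mapping.keys (c * x)"
        then obtain a where "m = a + Poly_Mapping.single i N"
          using keys_mult[of c x] i by (auto simp: var_power_def)
        then show ?thesis using i by (intro bexI[of _ i]) (simp_all add: lookup_add)
      qed (use step in blast)
    qed
  qed simp
next
  assume *: "\<forall>m\<in>Poly_Mapping.keys f. \<exists>i\<in>A. N \<le> Poly_Mapping.lookup m i"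
  have "monom m c \<in> idl.span (var_power N ` A)"
    if i: "i \<in> A" "N \<le> Poly_Mapping.lookup m i" for m c i
  proof -
    have "m = (m - Poly_Mapping.single i N) + Poly_Mapping.single i N"
      using i by (intro poly_mapping_eqI) (auto simp: lookup_add lookup_minus lookup_single when_def)
    then have "monom m c = monom (m - Poly_Mapping.single i N) c * var_power N i"
      by (simp add: var_power_def mult_single)
    then show ?thesis using i by (simp add: idl.span_scale idl.span_base)
  qed
  with * show "f \<in> idl.span (var_power N ` A)"
    by (subst mpoly_expand[of f]) (blast intro: idl.span_sum)
qed

lemma nonzerodivisor_var_power:
  assumes "j \<notin> A"
  shows "nonzerodivisor_mod (idl.span (var_power N ` A)) (var_power N j)"
  unfolding nonzerodivisor_mod_def
proof (intro allI impI)
  fix g :: "('a, 'b) mpoly"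
  assume *: "var_power N j * g \<in> idl.span (var_power N ` A)"
  show "g \<in> idl.span (var_power N ` A)"
    unfolding span_var_powers
  proof
    fix m assume "m \<in> Poly_Mapping.keys g"
    then have "Poly_Mapping.single j N + m \<in> Poly_Mapping.keys (var_power N j * g)"
      by (simp add: in_keys_iff var_power_def coeff_monom_mult)
    then obtain i where "i \<in> A" "N \<le> Poly_Mapping.lookup (Poly_Mapping.single j N + m) i"
      using * unfolding span_var_powers by blast
    moreover have "i \<noteq> j" using assms \<open>i \<in> A\<close> by blast
    ultimately show "\<exists>i\<in>A. N \<le> Poly_Mapping.lookup m i"
      by (auto simp: lookup_add lookup_single when_def)
  qed
qed

lemma regular_list_var_powers:
  assumes "distinct xs"
  shows "regular_list (map (var_power N) xs :: ('n, 'k::field_char_0) mpoly list)"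
  unfolding regular_list_def
proof (intro allI impI)
  fix i assume i: "i < length (map (var_power N) xs :: ('n, 'k) mpoly list)"
  have "xs ! i \<notin> set (take i xs)"
    using assms i by (auto simp: in_set_conv_nth nth_eq_iff_index_eq)
  then show "nonzerodivisor_mod (idl.span (set (take i (map (var_power N) xs))))
      (map (var_power N) xs ! i :: ('n, 'k) mpoly)"
    using i nonzerodivisor_var_power by (simp add: take_map)
qed

lemma one_notin_span_variables: "0 < N \<Longrightarrow> 1 \<notin> idl.span (var_power N ` A)"
  by (simp add: span_var_powers)

lemma var_power_homogeneous: "var_power N i \<in> homogeneous_component N"
  by (simp add: var_power_def homogeneous_component_iff mdeg_single)

lemma homogeneous_in_span_variables:
  assumes "f \<in> homogeneous_component d" "0 < d"
  shows "f \<in> idl.span (var_power 1 ` UNIV)"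
  unfolding span_var_powers
proof
  fix m assume "m \<in> Poly_Mapping.keys f"
  then have "mdeg m \<noteq> 0" using assms by (auto simp: homogeneous_component_iff)
  then obtain i where "Poly_Mapping.lookup m i \<noteq> 0" unfolding mdeg_def by fastforce
  then show "\<exists>i\<in>UNIV. 1 \<le> Poly_Mapping.lookup m i" by (auto intro!: exI[of _ i])
qed

lemma enumeration_UNIV:
  obtains xs :: "'n::finite list" where "distinct xs" "set xs = UNIV" "length xs = CARD('n)"
  using finite_distinct_list[of "UNIV :: 'n set"] distinct_card by (metis finite)

lemma trivial_relationsE:
  assumes "trivial_relations f n c"
  obtains e where "\<And>i j. e i j + e j i = 0" "\<And>i. e i i = 0"
    "\<And>i. i < n \<Longrightarrow> c i = (\<Sum>j<n. e i j * f j)"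
  using assms unfolding trivial_relations_def by blast

section \<open>Quadratic systems of parameters are regular sequences\<close>

text \<open>Nakayama's lemma in graded form. A relation between the first \<open>k\<close> quadrics is extended by zero
  and becomes a combination of trivial relations; the row of index \<open>k\<close> of the antisymmetric
  coefficient matrix is again a relation between the first \<open>k\<close> quadrics, of smaller degree.\<close>

lemma trivial_relations_drop:
  fixes f :: "nat \<Rightarrow> ('n::finite, 'k::field_char_0) mpoly"
  assumes rel: "\<And>c. (\<Sum>i<Suc k. c i * f i) = 0 \<Longrightarrow> trivial_relations f (Suc k) c"
    and hom: "\<And>i. i \<le> k \<Longrightarrow> f i \<in> homogeneous_component 2"
    and c: "(\<Sum>i<k. c i * f i) = 0"
  shows "trivial_relations f k c"
proof -
  \<comment> \<open>The induction runs over a strict bound \<open>D\<close> for the degrees of all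
    coefficients of the relation.\<close>
  have bounded: "trivial_relations f k c"
    if "(\<Sum>i<k. c i * f i) = 0" "\<And>i m. i < k \<Longrightarrow> m \<in> Poly_Mapping.keys (c i) \<Longrightarrow> mdeg m < D" for c D
    using that
  proof (induction D arbitrary: c)
    case 0
    then have "c i = 0" if "i < k" for i using that by (metis keys_eq_empty ex_in_conv not_less0)
    then show ?case unfolding trivial_relations_def by (intro exI[of _ "\<lambda>_ _. 0"]) simp
  next
    case (Suc D)
    define c' where "c' i = (if i < k then c i else 0)" for i
    have "(\<Sum>i<k. c' i * f i) = (\<Sum>i<k. c i * f i)" by (intro sum.cong) (auto simp: c'_def)
    with Suc.prems(1) have c'0: "(\<Sum>i<Suc k. c' i * f i) = 0" by (simp add: c'_def)
    obtain e where e: "\<And>i j. e i j + e j i = 0" "\<And>i. e i i = 0"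
      "\<And>i. i < Suc k \<Longrightarrow> c' i = (\<Sum>j<Suc k. e i j * f j)"
      using rel[OF c'0] by (rule trivial_relationsE) blast
    \<comment> \<open>The left-hand sides have degree at most \<open>D\<close> and the quadrics add
      two, so only the parts of \<open>e\<close> of degree at most \<open>D - 2\<close> matter.
      Truncation keeps the matrix alternating and forces the degrees in row \<open>k\<close> below
      \<open>D\<close>, as the induction hypothesis requires.\<close>
    define t where "t i j = restrict (\<lambda>m. mdeg m + 2 < Suc D) (e i j)" for i j
    have t: "t i j + t j i = 0" for i j
      unfolding t_def using e(1)[of i j] by (metis restrict_0 restrict_add)
    have tii: "t i i = 0" for i by (simp add: t_def e(2) restrict_0)
    have ct: "c' i = (\<Sum>j<Suc k. t i j * f j)" if "i < Suc k" for i
    proof -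
      have "c' i = restrict (\<lambda>m. mdeg m < Suc D) (c' i)"
        using Suc.prems(2)[of i] by (intro restrict_id[symmetric]) (auto simp: c'_def split: if_splits)
      also have "\<dots> = (\<Sum>j<Suc k. restrict (\<lambda>m. mdeg m < Suc D) (e i j * f j))"
        by (subst e(3)[OF that]) (rule restrict_sum)
      also have "\<dots> = (\<Sum>j<Suc k. t i j * f j)"
        unfolding t_def using hom
        by (intro sum.cong refl restrict_mult) (auto simp: homogeneous_component_iff mdeg_add less_Suc_eq_le)
      finally show ?thesis .
    qed
    have "(\<Sum>j<k. t k j * f j) = 0" using ct[of k] by (simp add: c'_def tii)
    moreover have "mdeg m < D" if "m \<in> Poly_Mapping.keys (t k j)" for m j
      using that by (simp add: t_def keys_restrict)
    ultimately have "trivial_relations f k (t k)" by (rule Suc.IH)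
    then obtain g where g: "\<And>i j. g i j + g j i = 0" "\<And>i. g i i = 0"
      "\<And>i. i < k \<Longrightarrow> t k i = (\<Sum>j<k. g i j * f j)"
      by (rule trivial_relationsE) blast
    \<comment> \<open>The last column is minus the last row, which is an alternating combination of
      the earlier quadrics with matrix \<open>g\<close>. Absorbing it gives the correction
      \<open>- g i j * f k\<close>, again alternating.\<close>
    have "c i = (\<Sum>j<k. (t i j - g i j * f k) * f j)" if i: "i < k" for i
    proof -
      have "t i k = - (\<Sum>j<k. g i j * f j)"
        using t[of i k] g(3)[OF i] by (simp add: eq_neg_iff_add_eq_0)
      then have "c i = (\<Sum>j<k. t i j * f j) - (\<Sum>j<k. g i j * f j) * f k"
        using ct[of i] i by (simp add: c'_def)
      then show ?thesis
        by (simp add: left_diff_distrib sum_subtractf sum_distrib_left algebra_simps)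
    qed
    moreover have "(t i j - g i j * f k) + (t j i - g j i * f k) = 0" for i j
    proof -
      have "(t i j - g i j * f k) + (t j i - g j i * f k) = (t i j + t j i) - (g i j + g j i) * f k"
        by (simp add: algebra_simps)
      then show ?thesis by (simp add: t g(1))
    qed
    moreover have "t i i - g i i * f k = 0" for i by (simp add: tii g(2))
    ultimately show ?case
      unfolding trivial_relations_def by (intro exI[of _ "\<lambda>i j. t i j - g i j * f k"]) blast
  qed
  have "finite (\<Union>i<k. mdeg ` Poly_Mapping.keys (c i))" by simp
  then obtain D where "\<forall>d\<in>(\<Union>i<k. mdeg ` Poly_Mapping.keys (c i)). d < D"
    using finite_nat_set_iff_bounded by blast
  then show ?thesis by (intro bounded[OF c]) auto
qed

lemma nth_image_lessThan: "k \<le> length fs \<Longrightarrow> set (take k fs) = (!) fs ` {..<k}"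
  by (simp add: nth_image lessThan_atLeast0)

text \<open>Exactness in degree one makes all relations between the \<open>n\<close> quadrics
  trivial. Dropping the last quadric repeatedly gives this for every initial segment, and regularity
  at position \<open>k\<close> concerns only relations between the first \<open>k + 1\<close>
  quadrics.\<close>

lemma regular_list_quadrics:
  fixes fs :: "('n::finite, 'k::field_char_0) mpoly list"
  assumes len: "length fs = CARD('n)" and hom: "set fs \<subseteq> homogeneous_component 2"
    and powers: "\<And>i. var_power N i \<in> idl.span (set fs)"
  shows "regular_list fs"
proof -
  let ?n = "CARD('n)"
  obtain xs :: "'n list" where xs: "distinct xs" "set xs = UNIV" "length xs = ?n"
    by (rule enumeration_UNIV)
  have fs: "set fs = (!) fs ` {..<?n}" using nth_image_lessThan[of ?n fs] len by simp
  have "koszul_exact ((!) fs) ?n (idl.span (set (take 0 (map (var_power N) xs)))) 1"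
    using xs powers fs by (intro koszul_exact_regular[OF regular_list_var_powers]) auto
  then have exact: "koszul_exact ((!) fs) ?n {0} 1" by simp
  have rel: "trivial_relations ((!) fs) k c"
    if "k \<le> ?n" "(\<Sum>i<k. c i * fs ! i) = 0" for k c
    using that
  proof (induction arbitrary: c rule: inc_induct)
    case base
    then show ?case by (rule koszul_exact_imp_trivial_relations[OF exact])
  next
    case (step k)
    have "fs ! i \<in> homogeneous_component 2" if "i \<le> k" for i
      using hom that step.hyps len by (auto simp: subset_iff)
    then show ?case using step by (intro trivial_relations_drop[where k = k and f = "(!) fs"]) auto
  qed
  show ?thesis
    unfolding regular_list_def nonzerodivisor_mod_def
  proof (intro allI impI)
    fix k g assume k: "k < length fs" and g: "fs ! k * g \<in> idl.span (set (take k fs))"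
    have take: "set (take k fs) = (!) fs ` {..<k}" using k by (simp add: nth_image_lessThan)
    obtain b where b: "fs ! k * g = (\<Sum>i<k. b i * fs ! i)"
      using g unfolding take by (rule span_image_lessThan)
    define c where "c i = (if i < k then - b i else g)" for i
    have "(\<Sum>i<k. c i * fs ! i) = - (\<Sum>i<k. b i * fs ! i)"
      unfolding sum_negf[symmetric] by (intro sum.cong) (auto simp: c_def)
    then have "(\<Sum>i<Suc k. c i * fs ! i) = 0" using b by (simp add: c_def mult.commute)
    then have "trivial_relations ((!) fs) (Suc k) c" using k len by (intro rel) auto
    \<comment> \<open>Row \<open>k\<close> has zero diagonal entry, so \<open>g\<close> is a
      combination of the earlier quadrics alone.\<close>
    then obtain e where "e k k = 0" "c k = (\<Sum>j<Suc k. e k j * fs ! j)"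
      unfolding trivial_relations_def by blast
    then have "g = (\<Sum>j<k. e k j * fs ! j)" by (simp add: c_def)
    then show "g \<in> idl.span (set (take k fs))"
      unfolding take by (simp, intro idl.span_sum) (blast intro: idl.span_scale idl.span_base)
  qed
qed

section \<open>Finite-dimensional subspaces\<close>

text \<open>A finite spanning set is required because \<open>dim\<close> takes the value 0 on
  infinite-dimensional spaces.\<close>

lemma (in vector_space) dim_insert_finite:
  assumes "finite S" "V \<subseteq> span S"
  shows "dim (insert b V) = (if b \<in> span V then dim V else dim V + 1)"
proof (cases "b \<in> span V")
  case True
  then show ?thesis using span_redundant[OF True] by (metis dim_span)
next
  case False
  obtain C where C: "C \<subseteq> V" "independent C" "V \<subseteq> span C" "card C = dim V"
    by (rule basis_exists)
  have fin: "finite C" using independent_span_bound[OF assms(1) C(2)] C(1) assms(2) by auto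
  have sp: "span C = span V" using C by (simp add: span_eq span_superset subset_trans[OF C(1)])
  with False have "b \<notin> span C" by simp
  then have ind: "independent (insert b C)" using C(2) by (rule independent_insertI)
  have "span (insert b C) = span (insert b V)" using sp by (simp add: span_insert)
  then have "dim (insert b V) = card (insert b C)" using ind by (rule dim_eq_card)
  also have "b \<notin> C" using \<open>b \<notin> span C\<close> span_base by blast
  then have "card (insert b C) = dim V + 1" using fin C(4) by simp
  finally show ?thesis using False by simp
qed

text \<open>Relative rank-nullity: \<open>g\<close> induces an injection of \<open>U\<close> modulo
  \<open>W\<close> into the whole space modulo \<open>W'\<close>, so adjoining \<open>B\<close> to
  \<open>W\<close> raises the dimension by as much as adjoining its image to \<open>W'\<close>. The
  additive form avoids truncated subtraction.\<close>

lemma (in vector_space) dim_image_complement: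
  assumes fin: "finite S" "W \<subseteq> span S" "finite S'" "W' \<subseteq> span S'"
    and sub: "subspace W" "subspace W'" "subspace U" "W \<subseteq> U"
    and lin: "\<And>x y. g (x + y) = g x + g y" "\<And>c x. g (scale c x) = scale c (g x)"
    and kernel: "\<And>u. u \<in> U \<Longrightarrow> g u \<in> W' \<longleftrightarrow> u \<in> W"
    and B: "finite B" "B \<subseteq> U"
  shows "dim (W' \<union> g ` B) + dim W = dim W' + dim (W \<union> B)"
  using B
proof (induction B rule: finite_induct)
  case (insert b B)
  have sp: "span W = W" "span W' = W'" using sub by (simp_all only: span_eq_iff)
  have hom: "module_hom scale scale g"
    by unfold_locales (simp_all add: lin)
  have image: "g ` span B = span (g ` B)" by (rule module_hom.span_image[OF hom, symmetric])
  have iff: "g b \<in> span (W' \<union> g ` B) \<longleftrightarrow> b \<in> span (W \<union> B)"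
  proof
    assume "g b \<in> span (W' \<union> g ` B)"
    then obtain w s where "w \<in> W'" "s \<in> span B" "g b = w + g s"
      unfolding span_Un image[symmetric] sp by blast
    then have "g (b - s) \<in> W'"
      using lin(1)[of "b - s" s] by simp
    moreover have "s \<in> U" using \<open>s \<in> span B\<close> insert.prems sub(3) span_minimal[of B U] by auto
    then have "b - s \<in> U" using insert.prems sub(3) subspace_diff by auto
    ultimately have "b - s \<in> W" using kernel by blast
    then have "(b - s) + s \<in> span (W \<union> B)"
      using \<open>s \<in> span B\<close> span_mono[of B "W \<union> B"] by (intro span_add[OF span_base]) auto
    then show "b \<in> span (W \<union> B)" by simp
  next
    assume "b \<in> span (W \<union> B)"
    then obtain w s where ws: "w \<in> W" "s \<in> span B" "b = w + s"
      unfolding span_Un sp by blast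
    then have "g w \<in> W'" "g s \<in> span (g ` B)" using kernel sub(4) image by auto
    then show "g b \<in> span (W' \<union> g ` B)"
      unfolding ws lin using span_mono[of "g ` B" "W' \<union> g ` B"]
      by (intro span_add[OF span_base]) auto
  qed
  have "dim (insert b (W \<union> B)) = (if b \<in> span (W \<union> B) then dim (W \<union> B) else dim (W \<union> B) + 1)"
    using fin insert.hyps by (intro dim_insert_finite[of "S \<union> B"])
      (auto intro: subsetD[OF span_mono[of S "S \<union> B"]] span_base)
  moreover have "dim (insert (g b) (W' \<union> g ` B)) =
      (if g b \<in> span (W' \<union> g ` B) then dim (W' \<union> g ` B) else dim (W' \<union> g ` B) + 1)"
    using fin insert.hyps by (intro dim_insert_finite[of "S' \<union> g ` B"])
      (auto intro: subsetD[OF span_mono[of S' "S' \<union> g ` B"]] span_base)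
  ultimately show ?case using insert iff by simp
qed simp

lemma finite_mdeg: "finite {m :: 'n::finite \<Rightarrow>\<^sub>0 nat. mdeg m = d}"
proof -
  have "Poly_Mapping.lookup ` {m :: 'n \<Rightarrow>\<^sub>0 nat. mdeg m = d} \<subseteq> PiE UNIV (\<lambda>_. {..d})"
    by (auto simp: mdeg_def intro!: member_le_sum)
  moreover have "finite (PiE (UNIV :: 'n set) (\<lambda>_. {..d}))" by (intro finite_PiE) auto
  ultimately have "finite (Poly_Mapping.lookup ` {m :: 'n \<Rightarrow>\<^sub>0 nat. mdeg m = d})"
    by (rule finite_subset)
  moreover have "inj_on Poly_Mapping.lookup {m :: 'n \<Rightarrow>\<^sub>0 nat. mdeg m = d}"
    by (rule inj_onI) (rule poly_mapping_eqI, simp)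
  ultimately show ?thesis by (rule finite_imageD)
qed

definition monomials :: "nat \<Rightarrow> ('n::finite, 'k::field_char_0) mpoly set" where
  "monomials d = (\<lambda>m. monom m 1) ` {m. mdeg m = d}"

lemma finite_monomials: "finite (monomials d)"
  by (simp add: monomials_def finite_mdeg)

lemma span_monomials:
  "vs.span (monomials d :: ('n::finite, 'k::field_char_0) mpoly set) = homogeneous_component d"
    (is "vs.span ?M = ?R")
proof (rule vs.span_subspace)
  show "?M \<subseteq> ?R"
    using homogeneous_monom by (auto simp: monomials_def)
  show "?R \<subseteq> vs.span ?M"
  proof
    fix f assume f: "f \<in> ?R"
    have "monom m (coeff f m) \<in> vs.span ?M" if "m \<in> Poly_Mapping.keys f" for m
      using that f unfolding monom_eq[of m "coeff f m"]
      by (intro vs.span_scale vs.span_base) (auto simp: monomials_def homogeneous_component_iff)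
    then show "f \<in> vs.span ?M" by (subst mpoly_expand) (rule vs.span_sum)
  qed
qed (rule subspace_homogeneous_component)

lemma ideal_imp_subspace: "idl.subspace I \<Longrightarrow> vs.subspace I"
  by (auto simp: idl.subspace_def vs.subspace_def)

lemma subspace_span_ideal: "vs.subspace (idl.span A)"
  by (simp add: ideal_imp_subspace)

section \<open>Hilbert functions\<close>

definition hilbert_fun :: "('n::finite, 'k::field_char_0) mpoly set \<Rightarrow> nat \<Rightarrow> int" where
  "hilbert_fun I d = int (vs.dim (homogeneous_component d :: ('n, 'k) mpoly set))
     - int (vs.dim (I \<inter> homogeneous_component d))"

text \<open>With \<open>I\<close> generated by \<open>A\<close>, multiplication by \<open>r\<close>
  embeds the degree \<open>d - e\<close> part of \<open>R/I\<close> into its degree \<open>d\<close>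
  part, with cokernel the degree \<open>d\<close> part of \<open>R/(I, r)\<close>.\<close>

lemma hilbert_fun_insert:
  fixes r :: "('n::finite, 'k::field_char_0) mpoly"
  assumes hom: "\<And>g. g \<in> A \<Longrightarrow> \<exists>e. g \<in> homogeneous_component e"
    and r: "r \<in> homogeneous_component e" and nzd: "nonzerodivisor_mod (idl.span A) r"
  shows "hilbert_fun (idl.span (insert r A)) d =
    hilbert_fun (idl.span A) d - (if e \<le> d then hilbert_fun (idl.span A) (d - e) else 0)"
proof -
  let ?I = "idl.span A" and ?J = "idl.span (insert r A)"
  let ?R = "homogeneous_component :: nat \<Rightarrow> ('n, 'k) mpoly set"
  have IJ: "?I \<subseteq> ?J" by (rule idl.span_mono) auto
  have elem: "\<exists>a g. x = a + (if e \<le> d then r * g else 0) \<and> a \<in> ?I \<inter> ?R d \<and> g \<in> ?R (d - e)"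
    if x: "x \<in> ?J" "x \<in> ?R d" for x
  proof -
    obtain k where k: "x - k * r \<in> ?I" using x(1) by (auto simp: idl.span_breakdown_eq)
    have "x = hom_part d (x - k * r) + hom_part d (k * r)"
      using hom_part_id[OF x(2)] by (simp flip: restrict_add)
    moreover have "hom_part d (x - k * r) \<in> ?I" by (rule hom_part_ideal[OF hom k])
    ultimately show ?thesis
      using hom_part_in by (intro exI[of _ "hom_part d (x - k * r)"] exI[of _ "hom_part (d - e) k"])
        (auto simp: hom_part_mult[OF r] mult.commute)
  qed
  show ?thesis
  proof (cases "e \<le> d")
    case False
    have "?J \<inter> ?R d = ?I \<inter> ?R d" using elem False IJ by fastforce
    with False show ?thesis by (simp add: hilbert_fun_def)
  next
    case True
    let ?W = "?I \<inter> ?R (d - e)" and ?W' = "?I \<inter> ?R d" and ?B = "monomials (d - e) :: ('n, 'k) mpoly set"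
    have rR: "r * g \<in> ?R d" if "g \<in> ?R (d - e)" for g
      using homogeneous_mult[OF r that] True by simp
    have ker: "r * u \<in> ?W' \<longleftrightarrow> u \<in> ?W" if "u \<in> ?R (d - e)" for u
      using nzd rR[OF that] that idl.span_scale[of u A r] by (auto simp: nonzerodivisor_mod_def)
    have "vs.dim (?W' \<union> (*) r ` ?B) + vs.dim ?W = vs.dim ?W' + vs.dim (?W \<union> ?B)"
    proof (rule vs.dim_image_complement[of ?B _ "monomials d" _ "?R (d - e)"])
      show "?W \<subseteq> vs.span ?B" "?W' \<subseteq> vs.span (monomials d)" by (auto simp: span_monomials)
      show "vs.subspace ?W" "vs.subspace ?W'"
        by (intro vs.subspace_inter subspace_span_ideal subspace_homogeneous_component)+
      show "?B \<subseteq> ?R (d - e)" using vs.span_superset[of ?B] by (simp add: span_monomials)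
      show "r * u \<in> ?W' \<longleftrightarrow> u \<in> ?W" if "u \<in> ?R (d - e)" for u by (rule ker[OF that])
      show "r * (x + y) = r * x + r * y" "r * (const c * x) = const c * (r * x)" for x y c
        by (rule distrib_left, rule mult.left_commute)
    qed (auto simp: finite_monomials subspace_homogeneous_component)
    moreover have "vs.span (?W \<union> ?B) = ?R (d - e)"
    proof (rule vs.span_subspace)
      show "?W \<union> ?B \<subseteq> ?R (d - e)" using vs.span_superset[of ?B] by (simp add: span_monomials)
      show "?R (d - e) \<subseteq> vs.span (?W \<union> ?B)"
        using vs.span_mono[of ?B "?W \<union> ?B"] by (simp add: span_monomials)
    qed (rule subspace_homogeneous_component)
    then have "vs.dim (?W \<union> ?B) = vs.dim (?R (d - e))" by (metis vs.dim_span)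
    moreover have "vs.span (?W' \<union> (*) r ` ?B) = ?J \<inter> ?R d"
    proof (rule vs.span_subspace)
      have "r * b \<in> ?J" for b
        using idl.span_scale[OF idl.span_base, of r "insert r A" b] by (simp add: mult.commute)
      moreover have "?B \<subseteq> ?R (d - e)" using vs.span_superset[of ?B] by (simp add: span_monomials)
      ultimately show "?W' \<union> (*) r ` ?B \<subseteq> ?J \<inter> ?R d" using IJ rR by auto
      show "?J \<inter> ?R d \<subseteq> vs.span (?W' \<union> (*) r ` ?B)"
      proof
        fix x assume "x \<in> ?J \<inter> ?R d"
        then have "\<exists>a g. x = a + r * g \<and> a \<in> ?W' \<and> g \<in> ?R (d - e)"
          using elem[of x] True by simp
        then obtain a g where x: "x = a + r * g" "a \<in> ?W'" "g \<in> ?R (d - e)" by blast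
        have "g \<in> vs.span ?B" using x by (simp add: span_monomials)
        then have "r * g \<in> vs.span (?W' \<union> (*) r ` ?B)"
        proof (induction rule: vs.span_induct_alt)
          case (step c b y)
          have "r * b \<in> vs.span (?W' \<union> (*) r ` ?B)" using step by (intro vs.span_base) auto
          then have "const c * (r * b) + r * y \<in> vs.span (?W' \<union> (*) r ` ?B)"
            using step by (intro vs.span_add vs.span_scale)
          then show ?case by (simp add: algebra_simps)
        qed (simp add: vs.span_zero)
        then show "x \<in> vs.span (?W' \<union> (*) r ` ?B)"
          unfolding x using x by (intro vs.span_add vs.span_base[of a]) auto
      qed
    qed (intro vs.subspace_inter subspace_span_ideal subspace_homogeneous_component)
    then have "vs.dim (?W' \<union> (*) r ` ?B) = vs.dim (?J \<inter> ?R d)" by (metis vs.dim_span)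
    ultimately have "vs.dim (?J \<inter> ?R d) + vs.dim ?W = vs.dim ?W' + vs.dim (?R (d - e))" by simp
    then show ?thesis using True unfolding hilbert_fun_def by simp
  qed
qed

definition hilbert_fps :: "('n::finite, 'k::field_char_0) mpoly set \<Rightarrow> int fps" where
  "hilbert_fps I = Abs_fps (hilbert_fun I)"

lemma hilbert_fps_insert:
  assumes "\<And>g. g \<in> A \<Longrightarrow> \<exists>e. g \<in> homogeneous_component e"
    "r \<in> homogeneous_component e" "nonzerodivisor_mod (idl.span A) r"
  shows "hilbert_fps (idl.span (insert r A)) = hilbert_fps (idl.span A) * (1 - fps_X ^ e)"
  by (rule fps_ext)
    (simp add: hilbert_fps_def hilbert_fun_insert[OF assms] algebra_simps fps_X_power_mult_nth)

lemma hilbert_fps_regular_list: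
  fixes fs :: "('n::finite, 'k::field_char_0) mpoly list"
  assumes "regular_list fs" "\<And>f. f \<in> set fs \<Longrightarrow> f \<in> homogeneous_component (dg f)"
  shows "hilbert_fps (idl.span (set fs)) =
    hilbert_fps ({0} :: ('n, 'k) mpoly set) * prod_list (map (\<lambda>f. 1 - fps_X ^ dg f) fs)"
  using assms
proof (induction fs rule: rev_induct)
  case (snoc f fs)
  have "hilbert_fps (idl.span (insert f (set fs))) = hilbert_fps (idl.span (set fs)) * (1 - fps_X ^ dg f)"
    using snoc.prems by (intro hilbert_fps_insert) (auto simp: regular_list_append)
  then show ?case using snoc by (simp add: regular_list_append mult.assoc)
qed simp

text \<open>Instead of counting monomials, the regular sequence of the variables is used: it
  consists of forms of degree one, and its quotient is the field, with Hilbert series 1.\<close>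

lemma hilbert_fps_zero_ideal:
  "hilbert_fps ({0} :: ('n::finite, 'k::field_char_0) mpoly set) * (1 - fps_X) ^ CARD('n) = 1"
proof -
  obtain xs :: "'n list" where xs: "distinct xs" "set xs = UNIV" "length xs = CARD('n)"
    by (rule enumeration_UNIV)
  let ?m = "idl.span (range (var_power 1)) :: ('n, 'k) mpoly set"
  have "hilbert_fps ?m = hilbert_fps ({0} :: ('n, 'k) mpoly set) * prod_list (map (\<lambda>f. 1 - fps_X ^ 1) (map (var_power 1) xs :: ('n, 'k) mpoly list))"
    using hilbert_fps_regular_list[OF regular_list_var_powers[OF xs(1), of 1], of "\<lambda>_. 1"]
      var_power_homogeneous xs(2) by auto
  then have "hilbert_fps ?m = hilbert_fps ({0} :: ('n, 'k) mpoly set) * (1 - fps_X) ^ CARD('n)"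
    using xs(3) by (simp add: o_def map_replicate_const)
  moreover have "hilbert_fun ?m d = (if d = 0 then 1 else 0)" for d
  proof (cases "d = 0")
    case False
    then have "?m \<inter> homogeneous_component d = homogeneous_component d"
      using homogeneous_in_span_variables by auto
    with False show ?thesis by (simp add: hilbert_fun_def)
  next
    case True
    have "f = 0" if f: "f \<in> ?m" "f \<in> homogeneous_component 0" for f
    proof -
      have "m \<notin> Poly_Mapping.keys f" for m
        using f unfolding span_var_powers homogeneous_component_iff mdeg_def by fastforce
      then show "f = 0" by (metis all_not_in_conv keys_eq_empty)
    qed
    then have "?m \<inter> homogeneous_component 0 = {0}"
      using idl.span_zero vs.subspace_0[OF subspace_homogeneous_component] by auto
    then have "vs.dim (?m \<inter> homogeneous_component 0) = 0"
      using vs.dim_le_card[of "{0}" "{}"] by simp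
    moreover have "m = 0" if "mdeg m = 0" for m :: "'n \<Rightarrow>\<^sub>0 nat"
      using that by (intro poly_mapping_eqI) (simp add: mdeg_def)
    then have "{m :: 'n \<Rightarrow>\<^sub>0 nat. mdeg m = 0} = {0}" by (auto simp: mdeg_def)
    then have "monomials 0 = {1 :: ('n, 'k) mpoly}" by (simp add: monomials_def)
    then have "homogeneous_component 0 = vs.span {1 :: ('n, 'k) mpoly}"
      by (simp flip: span_monomials)
    then have "vs.dim (homogeneous_component 0 :: ('n, 'k) mpoly set) = 1"
      using vs.dim_span_eq_card_independent[of "{1 :: ('n, 'k) mpoly}"] by simp
    ultimately show ?thesis using True by (simp add: hilbert_fun_def)
  qed
  then have "hilbert_fps ?m = 1" by (intro fps_ext) (simp add: hilbert_fps_def)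
  ultimately show ?thesis by simp
qed

section \<open>Ideals and dimensions in HOL-Algebra\<close>

lemma ideal_class_iff: "ideal (I :: 'a::comm_ring_1 set) cring_class_ops \<longleftrightarrow> idl.subspace I"
proof
  assume "ideal I cring_class_ops"
  then interpret ideal I cring_class_ops .
  show "idl.subspace I"
    using additive_subgroup.zero_closed[OF is_additive_subgroup] a_closed I_l_closed
    by (intro idl.subspaceI) (auto simp: class_simps)
next
  assume I: "idl.subspace I"
  show "ideal I cring_class_ops"
  proof (rule idealI)
    show "ring cring_class_ops" by (rule cring.axioms(1)[OF cring_class])
    have inv: "inv\<^bsub>add_monoid cring_class_ops\<^esub> a = - a" for a :: 'a
      using uminus_class[of a] by (simp add: a_inv_def)
    show "subgroup I (add_monoid cring_class_ops)"
    proof (rule group.subgroupI[OF abelian_group.a_group])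
      show "abelian_group cring_class_ops" by (rule cring_class.abelian_group_axioms)
      show "I \<noteq> {}" using idl.subspace_0[OF I] by blast
      show "inv\<^bsub>add_monoid cring_class_ops\<^esub> a \<in> I" if "a \<in> I" for a
        unfolding inv using I that by (rule idl.subspace_neg)
    qed (use I in \<open>auto simp: class_simps idl.subspace_add\<close>)
    fix a x assume "a \<in> I"
    then have "x * a \<in> I" by (rule idl.subspace_scale[OF I])
    then show "x \<otimes>\<^bsub>cring_class_ops\<^esub> a \<in> I" "a \<otimes>\<^bsub>cring_class_ops\<^esub> x \<in> I"
      by (simp_all add: class_simps mult.commute)
  qed
qed

lemma genideal_class: "genideal cring_class_ops S = idl.span S"
proof
  show "genideal cring_class_ops S \<subseteq> idl.span S"
    by (rule ring.genideal_minimal[OF cring.axioms(1)[OF cring_class]])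
      (simp_all add: ideal_class_iff idl.span_superset)
  have "ideal (genideal cring_class_ops S) cring_class_ops"
    by (rule ring.genideal_ideal[OF cring.axioms(1)[OF cring_class]]) (auto simp: class_simps)
  moreover have "S \<subseteq> genideal cring_class_ops S"
    by (rule ring.genideal_self[OF cring.axioms(1)[OF cring_class]]) (auto simp: class_simps)
  ultimately show "idl.span S \<subseteq> genideal cring_class_ops S"
    by (simp add: ideal_class_iff idl.span_minimal)
qed

lemma regular_sequence_class:
  fixes fs :: "'a::comm_ring_1 list"
  shows "regular_sequence cring_class_ops fs \<longleftrightarrow> regular_list fs \<and> 1 \<notin> idl.span (set fs)"
proof -
  have "idl.span (set fs) = UNIV \<longleftrightarrow> 1 \<in> idl.span (set fs)"
    using idl.span_scale[of 1 "set fs"] by auto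
  moreover have "carrier (cring_class_ops :: 'a ring) = UNIV" by (simp add: cring_class_ops_def)
  ultimately show ?thesis
    by (simp add: regular_sequence_def genideal_class class_simps regular_list_def nonzerodivisor_mod_def)
qed

lemma ring_mpoly: "ring mpoly_ring"
  by (rule cring.axioms(1)[OF cring_class])

lemma subfield_const_field: "subfield const_field mpoly_ring"
proof (rule ring.subfieldI[OF ring_mpoly])
  have "subring const_field mpoly_ring"
  proof (rule ring.subringI[OF ring_mpoly])
    show "\<one>\<^bsub>mpoly_ring\<^esub> \<in> const_field" by (auto simp: const_field_def class_simps simp flip: const_1)
    show "\<ominus>\<^bsub>mpoly_ring\<^esub> h \<in> const_field" if "h \<in> const_field" for h
    proof -
      obtain c where "h = const c" using \<open>h \<in> const_field\<close> by (auto simp: const_field_def)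
      then have "- h = const (- c)" by (simp add: const_def single_uminus)
      then show ?thesis by (simp add: class_simps const_field_def)
    qed
  qed (auto simp: const_field_def class_simps simp flip: const_mult const_add)
  then show "subcring const_field mpoly_ring"
    by (rule cring.subcringI'[OF cring_class])
  show "Units (mpoly_ring\<lparr>carrier := const_field\<rparr>) = const_field - {\<zero>\<^bsub>mpoly_ring\<^esub>}"
    (is "?U = ?V")
  proof
    show "?U \<subseteq> ?V" by (auto simp: Units_def cring_class_ops_def)
    show "?V \<subseteq> ?U"
    proof
      fix x assume "x \<in> ?V"
      then obtain c where c: "x = const c" "x \<noteq> 0"
        by (auto simp: const_field_def cring_class_ops_def)
      then have "c \<noteq> 0" by (auto simp: const_0)
      with c have "const (inverse c) * x = 1" "x * const (inverse c) = 1"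
        by (simp_all add: const_1 flip: const_mult)
      then show "x \<in> ?U" using c by (auto simp: Units_def cring_class_ops_def const_field_def)
    qed
  qed
qed

lemma dimension_span_independent:
  assumes "finite B" "vs.independent B"
  shows "ring.dimension mpoly_ring (card B) const_field (vs.span B)"
  using assms
proof (induction B rule: finite_induct)
  case empty
  then show ?case using ring.zero_dim[OF ring_mpoly, of const_field] by (simp add: class_simps)
next
  case (insert b B)
  have "ring.line_extension mpoly_ring const_field b (vs.span B) = vs.span (insert b B)"
  proof (rule Set.set_eqI)
    fix x
    have "x \<in> ring.line_extension mpoly_ring const_field b (vs.span B)
        \<longleftrightarrow> (\<exists>c. \<exists>v\<in>vs.span B. x = const c * b + v)"
      by (simp add: ring.line_extension_mem_iff[OF ring_mpoly] class_simps const_field_def)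
    also have "\<dots> \<longleftrightarrow> (\<exists>c. x - const c * b \<in> vs.span B)"
      by (simp add: algebra_simps flip: diff_eq_eq)
    finally show "x \<in> ring.line_extension mpoly_ring const_field b (vs.span B)
        \<longleftrightarrow> x \<in> vs.span (insert b B)"
      by (simp add: vs.span_insert)
  qed
  moreover have "b \<notin> vs.span B" "vs.independent B"
    using insert by (auto simp: vs.independent_insert)
  ultimately show ?case
    using ring.Suc_dim[OF ring_mpoly, of b "vs.span B" "card B" const_field] insert
    by (simp add: class_simps)
qed

lemma dimension_subspace:
  assumes "finite S" "E \<subseteq> vs.span S" "vs.subspace E"
  shows "ring.dimension mpoly_ring (vs.dim E) const_field E"
proof -
  obtain B where B: "B \<subseteq> E" "vs.independent B" "E \<subseteq> vs.span B" "card B = vs.dim E"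
    by (rule vs.basis_exists)
  have "finite B" using vs.independent_span_bound[OF assms(1) B(2)] B(1) assms(2) by auto
  moreover have "vs.span B = E" using B assms(3) by (intro vs.span_subspace)
  ultimately show ?thesis using dimension_span_independent[of B] B by simp
qed

lemma ring_dim_subspace:
  assumes "finite S" "E \<subseteq> vs.span S" "vs.subspace E"
  shows "(ring.dim mpoly_ring over const_field) E = vs.dim E"
  by (rule ring.dimI[OF ring_mpoly subfield_const_field dimension_subspace[OF assms]])

lemma quotient_map_eq_zero_iff: "idl.subspace I \<Longrightarrow> quotient_map I x = I \<longleftrightarrow> x \<in> I"
proof -
  assume I: "idl.subspace I"
  have "quotient_map I x = (\<lambda>h. h + x) ` I"
    by (auto simp: quotient_map_def a_r_coset_def' class_simps)
  moreover have "(\<lambda>h. h + x) ` I = I \<longleftrightarrow> x \<in> I"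
  proof
    assume "(\<lambda>h. h + x) ` I = I"
    then have "0 + x \<in> I" using idl.subspace_0[OF I] by blast
    then show "x \<in> I" by simp
  next
    assume x: "x \<in> I"
    have "y \<in> (\<lambda>h. h + x) ` I" if "y \<in> I" for y
      using idl.subspace_diff[OF I that x] by (intro image_eqI[of _ _ "y - x"]) simp_all
    then show "(\<lambda>h. h + x) ` I = I" using idl.subspace_add[OF I _ x] by blast
  qed
  ultimately show ?thesis by simp
qed

lemma (in vector_space) nested_bases:
  assumes "finite S" "W \<subseteq> span S" "V \<subseteq> W"
  obtains C D where "C \<subseteq> V" "V \<subseteq> span C" "card C = dim V"
    "C \<subseteq> D" "W \<subseteq> span D" "card D = dim W" "finite D"
proof -
  obtain C where C: "C \<subseteq> V" "independent C" "V \<subseteq> span C" "card C = dim V"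
    by (rule basis_exists)
  have "C \<subseteq> W" using C(1) assms(3) by blast
  then obtain D where D: "C \<subseteq> D" "D \<subseteq> W" "independent D" "W \<subseteq> span D"
    using maximal_independent_subset_extend C(2) by blast
  have "D \<subseteq> span S" using D(2) assms(2) by blast
  then have "finite D" using independent_span_bound[OF assms(1) D(3)] by blast
  moreover have "card D = dim W" using D by (intro basis_card_eq_dim)
  ultimately show thesis using that C D by blast
qed

lemma (in vector_space) dim_subset_finite:
  assumes "finite S" "W \<subseteq> span S" "V \<subseteq> W"
  shows "dim V \<le> dim W"
  using nested_bases[OF assms] by (metis card_mono)

lemma (in vector_space) subspace_eq_of_dim_le:
  assumes "finite S" "W \<subseteq> span S" "V \<subseteq> W" "subspace V" "dim W \<le> dim V"
  shows "V = W"
proof -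
  obtain C D where CD: "C \<subseteq> V" "card C = dim V" "C \<subseteq> D" "W \<subseteq> span D" "card D = dim W" "finite D"
    using nested_bases[OF assms(1-3)] by metis
  then have "C = D" using assms(5) by (intro card_seteq) simp_all
  then have "W \<subseteq> span C" using CD by simp
  also have "span C \<subseteq> V" using CD(1) assms(4) by (rule span_minimal)
  finally show ?thesis using assms(3) by blast
qed

text \<open>Rank-nullity for the quotient map on each homogeneous component. Properness of
  \<open>I\<close> ensures that the image of the constants is a field.\<close>

lemma hilbert_series_eq:
  fixes I :: "('n::finite, 'k::field_char_0) mpoly set"
  assumes I: "idl.subspace I" "1 \<notin> I"
  shows "hilbert_series I = hilbert_fps I"
proof -
  interpret I: ideal I mpoly_ring using I by (simp add: ideal_class_iff)
  let ?Q = "mpoly_ring Quot I"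
  let ?R = "homogeneous_component :: nat \<Rightarrow> ('n, 'k) mpoly set"
  interpret hom: ring_hom_ring mpoly_ring ?Q "quotient_map I"
    unfolding quotient_map_def using I.rcos_ring_hom_ring by simp
  have zero: "\<zero>\<^bsub>?Q\<^esub> = I" by (simp add: FactRing_def)
  have one: "\<one>\<^bsub>?Q\<^esub> = quotient_map I 1" by (simp add: FactRing_def quotient_map_def class_simps)
  have neq: "\<one>\<^bsub>?Q\<^esub> \<noteq> \<zero>\<^bsub>?Q\<^esub>" using I by (simp add: zero one quotient_map_eq_zero_iff)
  have "(ring.dim ?Q over (quotient_map I ` const_field)) (quotient_map I ` ?R i)
      = vs.dim (?R i) - vs.dim (I \<inter> ?R i)" for i
  proof (rule ring.dimI[OF hom.S.ring_axioms])
    show "subfield (quotient_map I ` const_field) ?Q"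
      by (rule hom.img_is_subfield(2)[OF subfield_const_field neq])
    show "ring.dimension ?Q (vs.dim (?R i) - vs.dim (I \<inter> ?R i))
        (quotient_map I ` const_field) (quotient_map I ` ?R i)"
    proof (rule hom.rank_nullity_theorem[OF subfield_const_field neq])
      show "ring.dimension mpoly_ring (vs.dim (?R i)) const_field (?R i)"
        by (rule dimension_subspace[of "monomials i"])
          (simp_all add: finite_monomials span_monomials subspace_homogeneous_component)
      have "a_kernel (mpoly_ring\<lparr>carrier := ?R i\<rparr>) ?Q (quotient_map I)
          = I \<inter> ?R i"
        unfolding a_kernel_def' zero quotient_map_eq_zero_iff[OF I(1)] by auto
      moreover have "ring.dimension mpoly_ring (vs.dim (I \<inter> ?R i)) const_field
          (I \<inter> ?R i)"
        using vs.subspace_inter[OF ideal_imp_subspace[OF I(1)] subspace_homogeneous_component]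
        by (intro dimension_subspace[of "monomials i"]) (auto simp: finite_monomials span_monomials)
      ultimately show "ring.dimension mpoly_ring (vs.dim (I \<inter> ?R i)) const_field
          (a_kernel (mpoly_ring\<lparr>carrier := ?R i\<rparr>) ?Q (quotient_map I))"
        by simp
    qed
  qed
  moreover have "vs.dim (I \<inter> ?R i) \<le> vs.dim (?R i)" for i
    by (rule vs.dim_subset_finite[of "monomials i"]) (auto simp: finite_monomials span_monomials)
  ultimately show ?thesis
    by (intro fps_ext) (simp add: hilbert_series_def hilbert_fps_def hilbert_fun_def of_nat_diff)
qed

section \<open>Descending chains of ideals in the quotient\<close>

lemma restrict_sum_parts_in_ideal:
  assumes "vs.subspace I" "\<And>d. P d \<Longrightarrow> homogeneous_component d \<subseteq> I"
  shows "restrict (\<lambda>m. P (mdeg m)) f \<in> I"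
proof (subst sum_hom_parts, rule vs.subspace_sum[OF assms(1)])
  fix d assume "d \<in> mdeg ` Poly_Mapping.keys (restrict (\<lambda>m. P (mdeg m)) f)"
  then have "P d" by (auto simp: keys_restrict)
  then show "hom_part d (restrict (\<lambda>m. P (mdeg m)) f) \<in> I" using assms(2) hom_part_in by blast
qed

text \<open>Preimages of ideals contain \<open>I\<close>, hence all forms of degree above
  \<open>n\<close>, and are determined by their intersections with the finite-dimensional space of
  polynomials of degree at most \<open>n\<close>. A descending chain is constant from an index where
  that dimension is least.\<close>

lemma artinian_quotient:
  fixes I :: "('n::finite, 'k::field_char_0) mpoly set"
  assumes I: "idl.subspace I" and above: "\<And>d. n < d \<Longrightarrow> homogeneous_component d \<subseteq> I"
  shows "artinian (mpoly_ring Quot I)"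
  unfolding artinian_def
proof (intro allI impI)
  fix J :: "nat \<Rightarrow> ('n, 'k) mpoly set set"
  let ?Q = "mpoly_ring Quot I"
  assume J: "\<forall>k. ideal (J k) ?Q \<and> J (Suc k) \<subseteq> J k"
  then have anti: "J k \<subseteq> J m" if "m \<le> k" for k m
    using lift_Suc_antimono_le[of J m k] that by blast
  interpret I: ideal I mpoly_ring using I by (simp add: ideal_class_iff)
  interpret hom: ring_hom_ring mpoly_ring ?Q "quotient_map I"
    unfolding quotient_map_def using I.rcos_ring_hom_ring by simp
  define P where "P k = {f. quotient_map I f \<in> J k}" for k
  have P: "idl.subspace (P k)" for k
    using hom.ideal_vimage[of "J k"] J by (simp add: P_def ideal_class_iff class_simps)
  have IP: "I \<subseteq> P k" for k
  proof
    fix f assume "f \<in> I"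
    then have "quotient_map I f = \<zero>\<^bsub>?Q\<^esub>" using I by (simp add: quotient_map_eq_zero_iff FactRing_def)
    moreover have "\<zero>\<^bsub>?Q\<^esub> \<in> J k"
      using J by (meson additive_subgroup.zero_closed ideal_def)
    ultimately show "f \<in> P k" by (simp add: P_def)
  qed
  have JP: "J k = quotient_map I ` P k" for k
  proof -
    have "J k \<subseteq> carrier ?Q" using J by (meson additive_subgroup.a_subset ideal_def)
    also have "carrier ?Q = range (quotient_map I)"
      by (auto simp: FactRing_def A_RCOSETS_def' quotient_map_def class_simps)
    finally show ?thesis by (auto simp: P_def)
  qed
  define S where "S = (\<Union>d\<le>n. monomials d :: ('n, 'k) mpoly set)"
  have fin: "finite S" by (simp add: S_def finite_monomials)
  have split: "restrict (\<lambda>m. mdeg m \<le> n) f \<in> vs.span S" for f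
  proof (rule restrict_sum_parts_in_ideal)
    show "homogeneous_component d \<subseteq> vs.span S" if "d \<le> n" for d
      unfolding span_monomials[symmetric] S_def using that by (intro vs.span_mono) auto
  qed simp
  have P_iff: "f \<in> P k \<longleftrightarrow> restrict (\<lambda>m. mdeg m \<le> n) f \<in> P k \<inter> vs.span S" for f k
  proof -
    have "restrict (\<lambda>m. \<not> mdeg m \<le> n) f \<in> I"
      using above by (intro restrict_sum_parts_in_ideal) (auto simp: I ideal_imp_subspace)
    then have "restrict (\<lambda>m. \<not> mdeg m \<le> n) f \<in> P k" using IP by blast
    then show ?thesis
      using restrict_split[of f "\<lambda>m. mdeg m \<le> n"] split[of f] P[of k]
      by (metis IntD1 IntI add_diff_cancel_right' idl.subspace_add idl.subspace_diff)
  qed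
  obtain m where m: "\<And>k. vs.dim (P m \<inter> vs.span S) \<le> vs.dim (P k \<inter> vs.span S)"
    using ex_has_least_nat[of "\<lambda>_. True" _ "\<lambda>k. vs.dim (P k \<inter> vs.span S)"] by blast
  show "\<exists>m. \<forall>k\<ge>m. J k = J m"
  proof (intro exI[of _ m] allI impI)
    fix k assume "m \<le> k"
    then have "P k \<subseteq> P m" using anti by (auto simp: P_def)
    then have "P k \<inter> vs.span S = P m \<inter> vs.span S"
      using fin m[of k] vs.subspace_inter[OF ideal_imp_subspace[OF P[of k]] vs.subspace_span]
      by (intro vs.subspace_eq_of_dim_le[of S]) auto
    then have "P k = P m" using P_iff by blast
    then show "J k = J m" by (simp add: JP)
  qed
qed

section \<open>Products of factors \<open>1 - X^d\<close>\<close>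

lemma fps_prod_coeffs:
  fixes ds :: "nat list"
  assumes "\<And>d. d \<in> set ds \<Longrightarrow> e \<le> d" "0 < e"
  defines "P \<equiv> prod_list (map (\<lambda>d. 1 - fps_X ^ d :: int fps) ds)"
  shows "fps_nth P 0 = 1" "\<And>k. 0 < k \<Longrightarrow> k < e \<Longrightarrow> fps_nth P k = 0"
    "fps_nth P e = - int (count_list ds e)"
proof -
  have "fps_nth P 0 = 1 \<and> (\<forall>k. 0 < k \<and> k < e \<longrightarrow> fps_nth P k = 0) \<and> fps_nth P e = - int (count_list ds e)"
    unfolding P_def using assms(1)
  proof (induction ds)
    case Nil
    then show ?case using assms(2) by simp
  next
    case (Cons d ds)
    then consider "d = e" | "e < d" by fastforce
    then show ?case using Cons assms(2)
      by cases (auto simp: left_diff_distrib fps_X_power_mult_nth)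
  qed
  then show "fps_nth P 0 = 1" "\<And>k. 0 < k \<Longrightarrow> k < e \<Longrightarrow> fps_nth P k = 0"
    "fps_nth P e = - int (count_list ds e)" by blast+
qed

lemma prod_list_filter_count:
  fixes g :: "'a \<Rightarrow> 'b::comm_monoid_mult"
  shows "prod_list (map g xs) = g a ^ count_list xs a * prod_list (map g (filter (\<lambda>x. x \<noteq> a) xs))"
  by (induction xs) (simp_all add: mult.assoc mult.left_commute)

text \<open>The coefficient of \<open>X\<close> is 0 on the left and \<open>r - n\<close> on the
  right, so the right side is \<open>(1 - X^2)^n\<close>. The coefficient of \<open>X^2\<close>
  yields \<open>n\<close> factors of degree two; after cancelling them the remaining product is 1,
  whereas its least degree would leave a nonzero coefficient.\<close>

lemma degrees_of_quadratic_product: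
  assumes ge: "\<And>d. d \<in> set ds \<Longrightarrow> 2 \<le> d"
    and eq: "prod_list (map (\<lambda>d. 1 - fps_X ^ d :: int fps) ds) = (1 + fps_X) ^ r * (1 - fps_X) ^ n"
  shows "set ds \<subseteq> {2} \<and> length ds = n"
proof -
  let ?P = "\<lambda>ds. prod_list (map (\<lambda>d. 1 - fps_X ^ d :: int fps) ds)"
  have "fps_nth (?P ds) 1 = int r - int n"
    unfolding eq fps_mult_nth_1
    by (simp add: fps_power_first_eq[unfolded One_nat_def] fps_power_zeroth)
  moreover have "fps_nth (?P ds) 1 = 0" using ge by (intro fps_prod_coeffs(2)[of ds 2]) auto
  ultimately have "r = n" by simp
  have sq: "(1 + fps_X) ^ n * (1 - fps_X) ^ n = (1 - fps_X ^ 2 :: int fps) ^ n"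
    by (simp add: power2_eq_square algebra_simps flip: power_mult_distrib)
  have rep: "(1 - fps_X ^ 2 :: int fps) ^ n = ?P (replicate n 2)"
    by (simp add: prod_list_replicate)
  have "fps_nth (?P ds) 2 = - int (count_list ds 2)" using ge by (intro fps_prod_coeffs(3)) auto
  moreover have "fps_nth (?P (replicate n 2)) 2 = - int (count_list (replicate n 2) (2::nat))"
    by (intro fps_prod_coeffs(3)) auto
  moreover have "count_list (replicate n 2) (2::nat) = n" by (induction n) auto
  moreover have prod: "?P ds = (1 - fps_X ^ 2) ^ n" by (simp only: eq \<open>r = n\<close> sq)
  ultimately have count: "count_list ds 2 = n" by (simp only: rep)
  let ?fs = "filter (\<lambda>x. x \<noteq> 2) ds"
  have "(1 - fps_X ^ 2 :: int fps) ^ n * ?P ?fs = (1 - fps_X ^ 2) ^ n * 1"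
    using prod_list_filter_count[of "\<lambda>d. 1 - fps_X ^ d :: int fps" ds 2]
    by (simp only: prod count mult_1_right)
  moreover have "(1 - fps_X ^ 2 :: int fps) \<noteq> 0"
  proof
    assume "(1 - fps_X ^ 2 :: int fps) = 0"
    then have "fps_nth (1 - fps_X ^ 2 :: int fps) 0 = 0" by simp
    then show False by simp
  qed
  then have "(1 - fps_X ^ 2 :: int fps) ^ n \<noteq> 0" by simp
  ultimately have one: "?P ?fs = 1" unfolding mult_cancel_left by blast
  have "?fs = []"
  proof (rule ccontr)
    assume ne: "?fs \<noteq> []"
    define e where "e = Min (set ?fs)"
    have e: "e \<in> set ?fs"
      unfolding e_def by (rule Min_in[OF finite_set]) (use ne in \<open>simp only: set_empty not_False_eq_True\<close>)
    then have "2 \<le> e" using ge by simp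
    then have "0 < e" by simp
    moreover have "e \<le> d" if "d \<in> set ?fs" for d
      unfolding e_def using that by (rule Min_le[OF finite_set])
    ultimately have "fps_nth (?P ?fs) e = - int (count_list ?fs e)"
      by (intro fps_prod_coeffs(3))
    moreover have "count_list ?fs e \<noteq> 0" using e by (simp only: count_list_0_iff not_not)
    ultimately show False using one \<open>0 < e\<close> by simp
  qed
  then have all: "\<forall>x\<in>set ds. x = 2" by (simp add: filter_empty_conv)
  then have "count_list ds 2 = length ds" by (induction ds) auto
  with all count show ?thesis by auto
qed

lemma fps_one_plus_X_power_above: "n < d \<Longrightarrow> fps_nth ((1 + fps_X :: int fps) ^ n) d = 0"
proof (induction n arbitrary: d)
  case (Suc n)
  then show ?case by (cases d) (simp_all add: distrib_right)
qed simp

section \<open>The socle\<close>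

text \<open>Modulo the variables \<open>a\<close> is its constant term, and the variables send
  \<open>u\<close> into \<open>I\<close>. So \<open>a\<close> acts on the class of \<open>u\<close>
  as a scalar, invertible precisely when \<open>a\<close> lies outside the ideal of the
  variables.\<close>

lemma socle_unit_multiple:
  fixes a u :: "('n::finite, 'k::field_char_0) mpoly"
  assumes I: "idl.subspace I" and socle: "\<And>i. var_power 1 i * u \<in> I"
  shows "a \<in> idl.span (range (var_power 1)) \<Longrightarrow> a * u \<in> I"
    and "a \<notin> idl.span (range (var_power 1)) \<Longrightarrow> a * u \<in> I \<Longrightarrow> u \<in> I"
proof -
  let ?m = "idl.span (range (var_power 1)) :: ('n, 'k) mpoly set"
  have m: "b * u \<in> I" if "b \<in> ?m" for b
    using that
  proof (induction rule: idl.span_induct_alt)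
    case base
    then show ?case by (simp add: idl.subspace_0[OF I])
  next
    case (step c x y)
    then have "c * (x * u) + y * u \<in> I" using socle by (auto intro: idl.subspace_add[OF I] idl.subspace_scale[OF I])
    then show ?case by (simp add: algebra_simps)
  qed
  show "a * u \<in> I" if "a \<in> ?m" using that by (rule m)
  assume a: "a \<notin> ?m" "a * u \<in> I"
  let ?c = "coeff a 0"
  have "a - const ?c \<in> ?m"
    unfolding span_var_powers
  proof
    fix k assume "k \<in> Poly_Mapping.keys (a - const ?c)"
    then have "k \<noteq> 0" by (auto simp: in_keys_iff lookup_minus const_def)
    then obtain i where "Poly_Mapping.lookup k i \<noteq> 0"
      by (metis lookup_zero poly_mapping_eqI)
    then show "\<exists>i\<in>UNIV. 1 \<le> Poly_Mapping.lookup k i" by (auto intro!: exI[of _ i])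
  qed
  then have "(a - const ?c) * u \<in> I" by (rule m)
  from idl.subspace_diff[OF I a(2) this] have cu: "const ?c * u \<in> I" by (simp add: algebra_simps)
  have "?c \<noteq> 0"
    using a(1) \<open>a - const ?c \<in> ?m\<close> by (auto simp: const_0)
  then have "const (inverse ?c) * (const ?c * u) = u"
    by (simp add: const_1 flip: mult.assoc const_mult)
  with idl.subspace_scale[OF I cu, of "const (inverse ?c)"] show "u \<in> I" by simp
qed

lemma regular_quadrics_hilbert_fps:
  fixes fs :: "('n::finite, 'k::field_char_0) mpoly list"
  assumes "regular_list fs" "length fs = CARD('n)" "set fs \<subseteq> homogeneous_component 2"
  shows "hilbert_fps (idl.span (set fs)) = (1 + fps_X) ^ CARD('n)"
proof -
  have "hilbert_fps (idl.span (set fs)) =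
      hilbert_fps ({0} :: ('n, 'k) mpoly set) * (1 - fps_X ^ 2) ^ CARD('n)"
    using hilbert_fps_regular_list[OF assms(1), of "\<lambda>_. 2"] assms(2,3)
    by (auto simp: map_replicate_const prod_list_replicate)
  also have "(1 - fps_X ^ 2 :: int fps) ^ CARD('n) = (1 - fps_X) ^ CARD('n) * (1 + fps_X) ^ CARD('n)"
    by (simp add: power2_eq_square algebra_simps flip: power_mult_distrib)
  finally show ?thesis by (simp add: hilbert_fps_zero_ideal flip: mult.assoc)
qed

lemma homogeneous_component_subset_ideal:
  assumes I: "vs.subspace I" and "hilbert_fun I d = 0"
  shows "homogeneous_component d \<subseteq> I"
proof -
  have "I \<inter> homogeneous_component d = homogeneous_component d"
    using assms(2) vs.subspace_inter[OF I subspace_homogeneous_component]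
    by (intro vs.subspace_eq_of_dim_le[of "monomials d"])
      (simp_all add: hilbert_fun_def finite_monomials span_monomials)
  then show ?thesis by blast
qed

lemma regular_quadrics_generate_Ann:
  fixes F :: "('n::finite, 'k::field_char_0) mpoly"
  assumes F: "F \<in> homogeneous_component CARD('n)" "F \<noteq> 0"
    and fs: "regular_list fs" "length fs = CARD('n)" "set fs \<subseteq> quadratic_space F"
  shows "idl.span (set fs) = Ann F"
proof (rule ccontr)
  let ?n = "CARD('n)" and ?J = "idl.span (set fs)" and ?m = "idl.span (range (var_power 1)) :: ('n, 'k) mpoly set"
  assume "?J \<noteq> Ann F"
  moreover have JA: "?J \<subseteq> Ann F"
    using fs(3) by (intro idl.span_minimal Ann_ideal) (auto simp: quadratic_space_def)
  ultimately obtain g where g: "g \<in> Ann F" "g \<notin> ?J" by blast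
  have hom: "set fs \<subseteq> homogeneous_component 2" using fs(3) by (auto simp: quadratic_space_def)
  have above: "homogeneous_component d \<subseteq> ?J" if "?n < d" for d
  proof (rule homogeneous_component_subset_ideal[OF subspace_span_ideal])
    have "hilbert_fun ?J d = fps_nth (hilbert_fps ?J) d" by (simp add: hilbert_fps_def)
    then show "hilbert_fun ?J d = 0"
      using that by (simp add: regular_quadrics_hilbert_fps[OF fs(1,2) hom] fps_one_plus_X_power_above)
  qed
  have monom_in: "monom m 1 * x \<in> ?J" if "?n < mdeg m" for m x
    using above[OF that] homogeneous_monom[of m 1] idl.span_scale[of "monom m 1" "set fs" x]
    by (auto simp: mult.commute)
  \<comment> \<open>A monomial multiple of \<open>g\<close> outside the ideal, of greatest monomial
    degree: one more variable pushes it into the ideal, so it represents a socle element. The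
    maximum exists because monomials of degree above \<open>n\<close> lie in the ideal.\<close>
  obtain m where m: "monom m 1 * g \<notin> ?J" "\<And>k. monom k 1 * g \<notin> ?J \<Longrightarrow> mdeg k \<le> mdeg m"
  proof -
    have "monom 0 1 * g \<notin> ?J" using g by simp
    moreover have "mdeg k \<le> ?n" if "monom k 1 * g \<notin> ?J" for k
      using monom_in[of k g] that by (cases "?n < mdeg k") auto
    ultimately have "\<exists>m. monom m 1 * g \<notin> ?J \<and> (\<forall>k. monom k 1 * g \<notin> ?J \<longrightarrow> mdeg k \<le> mdeg m)"
      by (intro ex_has_greatest_nat[of "\<lambda>k. monom k 1 * g \<notin> ?J" 0 mdeg "Suc ?n"]) (auto simp: less_Suc_eq_le)
    with that show thesis by blast
  qed
  define u where "u = monom m 1 * g"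
  have u: "u \<in> Ann F" "u \<notin> ?J"
    using m(1) g(1) idl.subspace_scale[OF Ann_ideal] by (auto simp: u_def)
  have u_socle: "var_power 1 i * u \<in> ?J" for i
  proof (rule ccontr)
    assume "var_power 1 i * u \<notin> ?J"
    then have "monom (Poly_Mapping.single i 1 + m) 1 * g \<notin> ?J"
      by (simp add: var_power_def u_def mult_single flip: mult.assoc)
    from m(2)[OF this] show False by (simp add: mdeg_add mdeg_single del: One_nat_def)
  qed
  obtain k where k: "mdeg k = ?n" "monom k 1 \<notin> Ann F" by (rule Ann_degree_not_all[OF F])
  \<comment> \<open>The second socle element: its products with the variables have degree
    \<open>n + 1\<close>.\<close>
  let ?v = "monom k 1 :: ('n, 'k) mpoly"
  have v_socle: "var_power 1 i * ?v \<in> ?J" for i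
    using monom_in[of "Poly_Mapping.single i 1 + k" 1] k(1)
    by (simp add: var_power_def mult_single mdeg_add mdeg_single del: One_nat_def)
  obtain xs :: "'n list" where xs: "distinct xs" "set xs = UNIV" "length xs = ?n"
    by (rule enumeration_UNIV)
  let ?x = "\<lambda>i. var_power 1 (xs ! i) :: ('n, 'k) mpoly"
  have "(\<lambda>i. xs ! i) ` {..<?n} = UNIV" using nth_image_lessThan[of ?n xs] xs by simp
  then have range: "?x ` {..<?n} = range (var_power 1)" by (simp flip: image_image)
  obtain a b where ab: "\<not> (a \<in> ?m \<and> b \<in> ?m)" "a * u + b * ?v \<in> ?J"
  proof (rule socle_cyclic[OF fs(1,2), of ?x u ?v])
    show "set fs \<subseteq> idl.span (?x ` {..<?n})"
      unfolding range using hom homogeneous_in_span_variables[of _ 2] by (auto simp: subset_iff)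
    show "1 \<notin> idl.span (?x ` {..<?n})" unfolding range by (simp add: one_notin_span_variables)
    show "?x i * u \<in> ?J" "?x i * ?v \<in> ?J" for i by (rule u_socle, rule v_socle)
    fix a b
    assume "\<not> (a \<in> idl.span (?x ` {..<?n}) \<and> b \<in> idl.span (?x ` {..<?n}))" "a * u + b * ?v \<in> ?J"
    then show thesis using that unfolding range by blast
  qed
  \<comment> \<open>One of \<open>a\<close>, \<open>b\<close> has nonzero constant term. If
    \<open>b\<close> does not, then \<open>b * ?v\<close> and hence \<open>a * u\<close> lies in the
    ideal, forcing \<open>u\<close> into it. If \<open>b\<close> does, \<open>u\<close> being in the
    annihilator forces \<open>?v\<close> there as well.\<close>
  show False
  proof (cases "b \<in> ?m")
    case True
    then have "b * ?v \<in> ?J" by (intro socle_unit_multiple(1)[OF idl.subspace_span v_socle])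
    then have "a * u \<in> ?J" using ab(2) idl.span_add_eq2 by blast
    moreover have "a \<notin> ?m" using ab(1) True by blast
    ultimately have "u \<in> ?J" using socle_unit_multiple(2)[OF idl.subspace_span u_socle] by blast
    with u(2) show False by blast
  next
    case False
    have "a * u \<in> Ann F" using u(1) by (rule idl.subspace_scale[OF Ann_ideal])
    moreover have "a * u + b * ?v \<in> Ann F" using ab(2) JA by blast
    ultimately have "b * ?v \<in> Ann F" using idl.subspace_diff[OF Ann_ideal] by fastforce
    moreover have "var_power 1 i * ?v \<in> Ann F" for i using v_socle JA by blast
    ultimately have "?v \<in> Ann F" using socle_unit_multiple(2)[OF Ann_ideal] False by blast
    with k(2) show False by blast
  qed
qed

section \<open>The equivalence\<close>

lemma one_notin_Ann:
  assumes "F \<in> homogeneous_component n" "F \<noteq> 0" shows "1 \<notin> Ann F"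
proof
  assume "1 \<in> Ann F"
  then have "x \<in> Ann F" for x using idl.subspace_scale[OF Ann_ideal, of 1 F x] by simp
  with Ann_degree_not_all[OF assms] show False by metis
qed

text \<open>Zero entries and nonzero constants would put 1 into the annihilator, and linear forms
  are excluded, so all degrees are at least two. Multiplying the Hilbert series by
  \<open>(1 - X)^n\<close> then removes that of the polynomial ring and leaves an identity between
  products.\<close>

lemma quadratic_complete_intersection_degrees:
  fixes F :: "('n::finite, 'k::field_char_0) mpoly"
  assumes F: "F \<in> homogeneous_component n" "F \<noteq> 0"
    and linear: "\<And>f. f \<in> Ann F \<Longrightarrow> f \<in> homogeneous_component 1 \<Longrightarrow> f = 0"
    and fs: "regular_list fs" "\<And>f. f \<in> set fs \<Longrightarrow> \<exists>d. f \<in> homogeneous_component d"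
      "Ann F = idl.span (set fs)"
    and hilb: "hilbert_series (Ann F) = (1 + fps_X) ^ r"
  shows "set fs \<subseteq> homogeneous_component 2" "length fs = CARD('n)"
proof -
  have one: "1 \<notin> Ann F" by (rule one_notin_Ann[OF F])
  obtain dg where dg: "\<And>f. f \<in> set fs \<Longrightarrow> f \<in> homogeneous_component (dg f)"
    using fs(2) by metis
  have ge: "2 \<le> dg f" if f: "f \<in> set fs" for f
  proof (rule ccontr)
    assume "\<not> 2 \<le> dg f"
    then consider "dg f = 0" | "dg f = 1" by linarith
    moreover have fA: "f \<in> Ann F" using f fs(3) idl.span_base by blast
    \<comment> \<open>The zero polynomial is homogeneous of every degree, so the chosen degrees do
      not exclude it. A zero entry can be a nonzerodivisor only modulo the whole ring.\<close>
    moreover have "f \<noteq> 0"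
    proof
      assume "f = 0"
      with f obtain i where i: "i < length fs" "fs ! i = 0" by (auto simp: in_set_conv_nth)
      then have "fs ! i * 1 \<in> idl.span (set (take i fs))" by (simp add: idl.span_zero)
      then have "1 \<in> idl.span (set (take i fs))"
        using fs(1) i(1) unfolding regular_list_def nonzerodivisor_mod_def by blast
      then have "1 \<in> Ann F"
        using fs(3) idl.span_mono[OF set_take_subset[of i fs]] by blast
      with one show False ..
    qed
    moreover have False if "dg f = 0"
    proof -
      have "m = 0" if "mdeg m = 0" for m :: "'n \<Rightarrow>\<^sub>0 nat"
        using that by (intro poly_mapping_eqI) (simp add: mdeg_def)
      then have "coeff f m = 0" if "m \<noteq> 0" for m
        using dg[OF f] \<open>dg f = 0\<close> that by (auto simp: homogeneous_coeff)
      then have f_const: "f = const (coeff f 0)"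
        by (intro poly_mapping_eqI) (auto simp: const_def lookup_single when_def)
      then have "coeff f 0 \<noteq> 0" using \<open>f \<noteq> 0\<close> const_0 by metis
      then have "const (inverse (coeff f 0)) * f = 1"
        by (subst f_const) (simp add: const_1 flip: const_mult)
      then show False using one idl.subspace_scale[OF Ann_ideal fA] by metis
    qed
    ultimately show False using linear[of f] dg[OF f] by metis
  qed
  have "hilbert_fps (Ann F) = (1 + fps_X) ^ r"
    using hilb hilbert_series_eq[OF Ann_ideal one] by simp
  moreover have "hilbert_fps (Ann F) =
      hilbert_fps ({0} :: ('n, 'k) mpoly set) * prod_list (map (\<lambda>f. 1 - fps_X ^ dg f) fs)"
    unfolding fs(3) using fs(1) dg by (rule hilbert_fps_regular_list)
  ultimately have "(1 + fps_X) ^ r * (1 - fps_X) ^ CARD('n) =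
      hilbert_fps ({0} :: ('n, 'k) mpoly set) * (1 - fps_X) ^ CARD('n)
        * prod_list (map (\<lambda>f. 1 - fps_X ^ dg f) fs)"
    by (simp add: mult.assoc mult.left_commute mult.commute)
  then have "prod_list (map (\<lambda>d. 1 - fps_X ^ d :: int fps) (map dg fs)) = (1 + fps_X) ^ r * (1 - fps_X) ^ CARD('n)"
    by (simp add: hilbert_fps_zero_ideal o_def)
  then have *: "set (map dg fs) \<subseteq> {2} \<and> length (map dg fs) = CARD('n)"
    using ge by (intro degrees_of_quadratic_product) auto
  then show "length fs = CARD('n)" by simp
  show "set fs \<subseteq> homogeneous_component 2"
  proof
    fix f assume f: "f \<in> set fs"
    with * have "dg f = 2" by auto
    with dg[OF f] show "f \<in> homogeneous_component 2" by simp
  qed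
qed

theorem theorem3:
  fixes F :: "('n::finite, 'k::field_char_0) mpoly"
  assumes "F \<in> homogeneous_component CARD('n)"
    and "\<forall>c :: 'n \<Rightarrow> 'k. (\<Sum>i\<in>UNIV. const (c i) * partial_deriv i F) = 0 \<longrightarrow> (\<forall>i. c i = 0)"
  shows "quadratic_complete_intersection (Ann F) \<longleftrightarrow>
    ((ring.dim mpoly_ring over const_field) (quadratic_space F) = CARD('n) \<and>
       genideal mpoly_ring (quadratic_space F) = Ann F) \<or>
    (\<exists>fs. set fs \<subseteq> quadratic_space F \<and> length fs = CARD('n) \<and> regular_sequence mpoly_ring fs)"
    (is "?qci \<longleftrightarrow> ?generated \<or> ?regular")
proof -
  have F0: "F \<noteq> 0"
  proof
    assume "F = 0"
    then have "(\<Sum>i\<in>UNIV. const 1 * partial_deriv i F) = 0" by (simp add: partial_deriv_def)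
    with assms(2)[THEN spec, of "\<lambda>_. 1"] show False by simp
  qed
  note one = one_notin_Ann[OF assms(1) F0]
  have above: "homogeneous_component d \<subseteq> Ann F" if "CARD('n) < d" for d
    using Ann_above[OF assms(1) _ that] by blast
  \<comment> \<open>Condition (2) is the hub: it is equivalent to the complete intersection
    property, and condition (1) is only shown to imply it.\<close>
  have ?regular if qci: ?qci
  proof -
    obtain fs d where fs: "regular_sequence mpoly_ring fs" "\<forall>f\<in>set fs. \<exists>d. f \<in> homogeneous_component d"
      "Ann F = idl.span (set fs)" "hilbert_series (Ann F) = (1 + fps_X) ^ d"
      using qci unfolding quadratic_complete_intersection_def genideal_class by blast
    have "regular_list fs" using fs(1) by (simp add: regular_sequence_class)
    note * = quadratic_complete_intersection_degrees[OF assms(1) F0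
        Ann_linear_forms[OF assms(2)] this bspec[OF fs(2)] fs(3,4)]
    have "set fs \<subseteq> quadratic_space F"
      using *(1) fs(3) idl.span_superset by (auto simp: quadratic_space_def)
    with *(2) fs(1) show ?thesis by blast
  qed
  moreover have ?qci if regular: ?regular
  proof -
    obtain fs where fs: "set fs \<subseteq> quadratic_space F" "length fs = CARD('n)" "regular_sequence mpoly_ring fs"
      using regular by blast
    have reg: "regular_list fs" using fs(3) by (simp add: regular_sequence_class)
    have hom: "set fs \<subseteq> homogeneous_component 2" using fs(1) by (auto simp: quadratic_space_def)
    have span: "idl.span (set fs) = Ann F"
      by (rule regular_quadrics_generate_Ann[OF assms(1) F0 reg fs(2,1)])
    have "hilbert_series (Ann F) = (1 + fps_X) ^ CARD('n)"
      using regular_quadrics_hilbert_fps[OF reg fs(2) hom] hilbert_series_eq[OF Ann_ideal one]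
      by (simp add: span)
    moreover have "artinian (mpoly_ring Quot Ann F)"
      using Ann_ideal above by (rule artinian_quotient)
    ultimately show ?thesis
      unfolding quadratic_complete_intersection_def genideal_class
      using fs(3) hom span by blast
  qed
  moreover have ?regular if generated: ?generated
  proof -
    have Q: "vs.subspace (quadratic_space F)" "quadratic_space F \<subseteq> vs.span (monomials 2)"
      unfolding quadratic_space_def span_monomials
      by (auto intro: vs.subspace_inter[OF ideal_imp_subspace[OF Ann_ideal] subspace_homogeneous_component])
    obtain B where B: "B \<subseteq> quadratic_space F" "vs.independent B" "quadratic_space F \<subseteq> vs.span B"
      "card B = vs.dim (quadratic_space F)" by (rule vs.basis_exists)
    have "card B = CARD('n)"
      using generated B(4) ring_dim_subspace[OF finite_monomials Q(2,1)] by simp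
    moreover have "finite B" using calculation zero_less_card_finite by (metis card_ge_0_finite)
    ultimately obtain fs where fs: "set fs = B" "length fs = CARD('n)"
      using finite_distinct_list distinct_card by metis
    have "vs.span B \<subseteq> idl.span B"
      by (rule vs.span_minimal[OF idl.span_superset subspace_span_ideal])
    then have "idl.span (quadratic_space F) \<subseteq> idl.span B"
      using B(3) by (intro idl.span_minimal) auto
    moreover have "idl.span B \<subseteq> idl.span (quadratic_space F)" by (rule idl.span_mono[OF B(1)])
    ultimately have span: "idl.span (set fs) = Ann F" using generated fs(1) by (simp add: genideal_class)
    have "regular_list fs"
    proof (rule regular_list_quadrics[OF fs(2)])
      show "set fs \<subseteq> homogeneous_component 2" using B(1) fs(1) by (auto simp: quadratic_space_def)
      \<comment> \<open>The exponent \<open>n + 1\<close> exceeds the degree of \<open>F\<close>, so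
        these powers annihilate \<open>F\<close>.\<close>
      show "var_power (CARD('n) + 1) i \<in> idl.span (set fs)" for i
        unfolding span by (rule subsetD[OF above var_power_homogeneous]) simp
    qed
    then have "regular_sequence mpoly_ring fs" using span one by (simp add: regular_sequence_class)
    with fs B(1) show ?thesis by blast
  qed
  ultimately show ?thesis by blast
qed

end
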